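(* Let $A,B$ be rings, let ${}_B\Sigma_A$ be a $B$-$A$-bimodule such that $\Sigma_A$ is finitely generated and projective, and let $\{e_i^*,e_i\}\subseteq\Sigma^*\times\Sigma$ be a finite dual basis, i.e. $u=\sum_i e_ie_i^*(u)$ for all $u\in\Sigma$. The $A$-bimodule $\Sigma^*\otimes_B\Sigma$ is an $A$-coring with comultiplication $$\Delta:\Sigma^*\otimes_B\Sigma\to\Sigma^*\otimes_B\Sigma\otimes_A\Sigma^*\otimes_B\Sigma,\qquad \Delta(\varphi\otimes_B u)=\sum_i\varphi\otimes_B e_i\otimes_A e_i^*\otimes_B u,$$ and counit $$\epsilon:\Sigma^*\otimes_B\Sigma\to A,\qquad \epsilon(\varphi\otimes_B u)=\varphi(u).$$ Moreover, there is a ring anti-isomorphism ${}^*(\Sigma^*\otimes_B\Sigma)\cong\mathrm{End}({}_B\Sigma)$, where the first of these rings is the left dual of $\Sigma^*\otimes_B\Sigma$, endowed with the convolution product.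
   Context: All rings are associative unital algebras over a fixed commutative ring $K$; all bimodules centralize $K$. $\Sigma^*=\mathrm{Hom}_A(\Sigma,A)$ (right $A$-linear maps) is an $A$-$B$-bimodule via $(a\varphi b)(u)=a\varphi(bu)$, so $\Sigma^*\otimes_B\Sigma$ is an $A$-bimodule. An $A$-coring is an $A$-bimodule $\mathfrak{C}$ with $A$-bimodule maps $\Delta:\mathfrak{C}\to\mathfrak{C}\otimes_A\mathfrak{C}$ and $\epsilon:\mathfrak{C}\to A$ such that $(\mathfrak{C}\otimes_A\Delta)\Delta=(\Delta\otimes_A\mathfrak{C})\Delta$ and $(\epsilon\otimes_A\mathfrak{C})\Delta=\mathfrak{C}=(\mathfrak{C}\otimes_A\epsilon)\Delta$ (with an object's name denoting its identity map, and the usual identifications). The left dual of an $A$-coring $\mathfrak{C}$ is ${}^*\mathfrak{C}=\mathrm{Hom}({}_A\mathfrak{C},{}_AA)$, the left $A$-linear maps; its convolution product is $f*g=f\circ(\mathfrak{C}\otimes_A g)\circ\Delta$, i.e. $(f*g)(c)=\sum f(c_{(1)}g(c_{(2)}))$ for $\Delta(c)=\sum c_{(1)}\otimes_A c_{(2)}$, with unit $\epsilon$. Convention: $\mathrm{End}({}_B\Sigma)$ is the ring of left $B$-linear endomorphisms of $\Sigma$ with multiplication opposite to composition. *)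

theory Defs
  imports "HOL-Algebra.Free_Abelian_Groups" "HOL-Algebra.Generated_Groups" "HOL-Algebra.QuotRing"
    "HOL-Algebra.Module"
begin

text \<open>
  Rings are associative unital algebras over a commutative ring \<open>K\<close>. The library's
  \<^locale>\<open>algebra\<close> and \<^locale>\<open>module\<close> are confined to commutative algebras and scalars, so
  \<open>K\<close>-algebras, bimodules and their tensor products are set up here.
\<close>

locale assoc_algebra = module K R + ring R
  for K :: "('k, 'z) ring_scheme" and R :: "('k, 'a) module" (structure) +
  assumes smult_mult_left:
      "\<lbrakk>k \<in> carrier K; x \<in> carrier R; y \<in> carrier R\<rbrakk> \<Longrightarrow> (k \<odot> x) \<otimes> y = k \<odot> (x \<otimes> y)"
    and smult_mult_right:
      "\<lbrakk>k \<in> carrier K; x \<in> carrier R; y \<in> carrier R\<rbrakk> \<Longrightarrow> x \<otimes> (k \<odot> y) = k \<odot> (x \<otimes> y)"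

text \<open>
  As in \<^theory>\<open>HOL-Algebra.Module\<close>, the fields \<^const>\<open>mult\<close> and \<^const>\<open>one\<close> inherited from the
  ring record carry no meaning for a bimodule.
\<close>

record ('l, 'r, 'm) bimodule = "'m ring" +
  lsmult :: "['l, 'm] \<Rightarrow> 'm" (infixr \<open>\<rightharpoonup>\<index>\<close> 70)
  rsmult :: "['m, 'r] \<Rightarrow> 'm" (infixl \<open>\<leftharpoonup>\<index>\<close> 70)

locale bimodule = L?: assoc_algebra K L + R?: assoc_algebra K R + M?: abelian_group M
  for K :: "('k, 'z) ring_scheme" and L :: "('k, 'l) module" and R :: "('k, 'r) module"
    and M :: "('l, 'r, 'm) bimodule" (structure) +
  assumes lsmult_closed:
      "\<lbrakk>a \<in> carrier L; x \<in> carrier M\<rbrakk> \<Longrightarrow> a \<rightharpoonup> x \<in> carrier M"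
    and lsmult_l_distr:
      "\<lbrakk>a \<in> carrier L; b \<in> carrier L; x \<in> carrier M\<rbrakk> \<Longrightarrow> (a \<oplus>\<^bsub>L\<^esub> b) \<rightharpoonup> x = (a \<rightharpoonup> x) \<oplus> (b \<rightharpoonup> x)"
    and lsmult_r_distr:
      "\<lbrakk>a \<in> carrier L; x \<in> carrier M; y \<in> carrier M\<rbrakk> \<Longrightarrow> a \<rightharpoonup> (x \<oplus> y) = (a \<rightharpoonup> x) \<oplus> (a \<rightharpoonup> y)"
    and lsmult_assoc:
      "\<lbrakk>a \<in> carrier L; b \<in> carrier L; x \<in> carrier M\<rbrakk> \<Longrightarrow> (a \<otimes>\<^bsub>L\<^esub> b) \<rightharpoonup> x = a \<rightharpoonup> (b \<rightharpoonup> x)"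
    and lsmult_one:
      "x \<in> carrier M \<Longrightarrow> \<one>\<^bsub>L\<^esub> \<rightharpoonup> x = x"
    and rsmult_closed:
      "\<lbrakk>x \<in> carrier M; r \<in> carrier R\<rbrakk> \<Longrightarrow> x \<leftharpoonup> r \<in> carrier M"
    and rsmult_r_distr:
      "\<lbrakk>x \<in> carrier M; r \<in> carrier R; s \<in> carrier R\<rbrakk> \<Longrightarrow> x \<leftharpoonup> (r \<oplus>\<^bsub>R\<^esub> s) = (x \<leftharpoonup> r) \<oplus> (x \<leftharpoonup> s)"
    and rsmult_l_distr:
      "\<lbrakk>x \<in> carrier M; y \<in> carrier M; r \<in> carrier R\<rbrakk> \<Longrightarrow> (x \<oplus> y) \<leftharpoonup> r = (x \<leftharpoonup> r) \<oplus> (y \<leftharpoonup> r)"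
    and rsmult_assoc:
      "\<lbrakk>x \<in> carrier M; r \<in> carrier R; s \<in> carrier R\<rbrakk> \<Longrightarrow> x \<leftharpoonup> (r \<otimes>\<^bsub>R\<^esub> s) = (x \<leftharpoonup> r) \<leftharpoonup> s"
    and rsmult_one:
      "x \<in> carrier M \<Longrightarrow> x \<leftharpoonup> \<one>\<^bsub>R\<^esub> = x"
    and lsmult_rsmult_assoc:
      "\<lbrakk>a \<in> carrier L; x \<in> carrier M; r \<in> carrier R\<rbrakk> \<Longrightarrow> (a \<rightharpoonup> x) \<leftharpoonup> r = a \<rightharpoonup> (x \<leftharpoonup> r)"
    and centralizes:
      "\<lbrakk>k \<in> carrier K; x \<in> carrier M\<rbrakk> \<Longrightarrow> (k \<odot>\<^bsub>L\<^esub> \<one>\<^bsub>L\<^esub>) \<rightharpoonup> x = x \<leftharpoonup> (k \<odot>\<^bsub>R\<^esub> \<one>\<^bsub>R\<^esub>)"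

definition regular_bimodule :: "('k, 'a) module \<Rightarrow> ('a, 'a, 'a) bimodule" where
  "regular_bimodule A =
     \<lparr>carrier = carrier A, monoid.mult = monoid.mult A, one = one A,
      zero = \<zero>\<^bsub>A\<^esub>, add = add A, lsmult = monoid.mult A, rsmult = monoid.mult A\<rparr>"


subsection \<open>Linear maps\<close>

text \<open>
  Sets of linear maps that occur as carriers consist of functions that are \<^const>\<open>undefined\<close> off
  the carrier of the domain, so that equality of functions is equality of maps.
\<close>

definition hom_left ::
    "('k, 'l) module \<Rightarrow> ('l, 'r, 'm) bimodule \<Rightarrow> ('l, 's, 'n) bimodule \<Rightarrow> ('m \<Rightarrow> 'n) set" where
  "hom_left L M N =
     {f \<in> carrier M \<rightarrow>\<^sub>E carrier N.
        (\<forall>x\<in>carrier M. \<forall>y\<in>carrier M. f (x \<oplus>\<^bsub>M\<^esub> y) = f x \<oplus>\<^bsub>N\<^esub> f y) \<and>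
        (\<forall>a\<in>carrier L. \<forall>x\<in>carrier M. f (a \<rightharpoonup>\<^bsub>M\<^esub> x) = a \<rightharpoonup>\<^bsub>N\<^esub> f x)}"

definition hom_right ::
    "('k, 'r) module \<Rightarrow> ('l, 'r, 'm) bimodule \<Rightarrow> ('s, 'r, 'n) bimodule \<Rightarrow> ('m \<Rightarrow> 'n) set" where
  "hom_right R M N =
     {f \<in> carrier M \<rightarrow>\<^sub>E carrier N.
        (\<forall>x\<in>carrier M. \<forall>y\<in>carrier M. f (x \<oplus>\<^bsub>M\<^esub> y) = f x \<oplus>\<^bsub>N\<^esub> f y) \<and>
        (\<forall>x\<in>carrier M. \<forall>a\<in>carrier R. f (x \<leftharpoonup>\<^bsub>M\<^esub> a) = f x \<leftharpoonup>\<^bsub>N\<^esub> a)}"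

definition bimodule_hom ::
    "('k, 'l) module \<Rightarrow> ('k, 'r) module \<Rightarrow> ('l, 'r, 'm) bimodule \<Rightarrow> ('l, 'r, 'n) bimodule \<Rightarrow>
      ('m \<Rightarrow> 'n) set" where
  "bimodule_hom L R M N =
     {f \<in> carrier M \<rightarrow> carrier N.
        (\<forall>x\<in>carrier M. \<forall>y\<in>carrier M. f (x \<oplus>\<^bsub>M\<^esub> y) = f x \<oplus>\<^bsub>N\<^esub> f y) \<and>
        (\<forall>a\<in>carrier L. \<forall>x\<in>carrier M. f (a \<rightharpoonup>\<^bsub>M\<^esub> x) = a \<rightharpoonup>\<^bsub>N\<^esub> f x) \<and>
        (\<forall>x\<in>carrier M. \<forall>a\<in>carrier R. f (x \<leftharpoonup>\<^bsub>M\<^esub> a) = f x \<leftharpoonup>\<^bsub>N\<^esub> a)}"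

definition right_dual ::
    "('k, 'a) module \<Rightarrow> ('b, 'a, 's) bimodule \<Rightarrow> ('a, 'b, 's \<Rightarrow> 'a) bimodule" where
  "right_dual A M =
     \<lparr>carrier = hom_right A M (regular_bimodule A),
      monoid.mult = undefined, one = undefined,
      zero = (\<lambda>u\<in>carrier M. \<zero>\<^bsub>A\<^esub>),
      add = (\<lambda>\<phi> \<psi>. \<lambda>u\<in>carrier M. \<phi> u \<oplus>\<^bsub>A\<^esub> \<psi> u),
      lsmult = (\<lambda>a \<phi>. \<lambda>u\<in>carrier M. a \<otimes>\<^bsub>A\<^esub> \<phi> u),
      rsmult = (\<lambda>\<phi> b. \<lambda>u\<in>carrier M. \<phi> (b \<rightharpoonup>\<^bsub>M\<^esub> u))\<rparr>"


subsection \<open>Finitely generated projective right modules\<close>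

definition fin_gen_right :: "('k, 'a) module \<Rightarrow> ('b, 'a, 's) bimodule \<Rightarrow> bool" where
  "fin_gen_right A M \<longleftrightarrow>
     (\<exists>S \<subseteq> carrier M. finite S \<and>
        (\<forall>u\<in>carrier M. \<exists>a \<in> S \<rightarrow> carrier A. u = (\<Oplus>\<^bsub>M\<^esub>s\<in>S. s \<leftharpoonup>\<^bsub>M\<^esub> a s)))"

definition free_bimodule :: "('k, 'a) module \<Rightarrow> 'j set \<Rightarrow> ('a, 'a, 'j \<Rightarrow> 'a) bimodule" where
  "free_bimodule A J =
     \<lparr>carrier = {f \<in> J \<rightarrow>\<^sub>E carrier A. finite {j \<in> J. f j \<noteq> \<zero>\<^bsub>A\<^esub>}},
      monoid.mult = undefined, one = undefined,
      zero = (\<lambda>j\<in>J. \<zero>\<^bsub>A\<^esub>),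
      add = (\<lambda>f g. \<lambda>j\<in>J. f j \<oplus>\<^bsub>A\<^esub> g j),
      lsmult = (\<lambda>a f. \<lambda>j\<in>J. a \<otimes>\<^bsub>A\<^esub> f j),
      rsmult = (\<lambda>f a. \<lambda>j\<in>J. f j \<otimes>\<^bsub>A\<^esub> a)\<rparr>"

text \<open>
  A projective module is a direct summand of a free module. The basis \<open>J\<close> may be taken inside
  the type of \<open>M\<close>, since \<open>M\<close> is then also a summand of the free module on any generating set of
  its own.
\<close>

definition projective_right :: "('k, 'a) module \<Rightarrow> ('b, 'a, 's) bimodule \<Rightarrow> bool" where
  "projective_right A M \<longleftrightarrow>
     (\<exists>(J :: 's set) i p. i \<in> hom_right A M (free_bimodule A J) \<and>
        p \<in> hom_right A (free_bimodule A J) M \<and> (\<forall>u\<in>carrier M. p (i u) = u))"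

definition dual_basis ::
    "('k, 'a) module \<Rightarrow> ('b, 'a, 's) bimodule \<Rightarrow> 'i set \<Rightarrow> ('i \<Rightarrow> 's \<Rightarrow> 'a) \<Rightarrow> ('i \<Rightarrow> 's) \<Rightarrow> bool" where
  "dual_basis A M I e' e \<longleftrightarrow>
     finite I \<and> e' \<in> I \<rightarrow> carrier (right_dual A M) \<and> e \<in> I \<rightarrow> carrier M \<and>
     (\<forall>u\<in>carrier M. u = (\<Oplus>\<^bsub>M\<^esub>i\<in>I. e i \<leftharpoonup>\<^bsub>M\<^esub> e' i u))"


subsection \<open>Tensor products\<close>

text \<open>
  \<open>M \<otimes>\<^sub>R N\<close> is the quotient of the free abelian group on pairs \<open>(m, n)\<close> by the subgroup generated
  by the relations of biadditivity and \<open>R\<close>-balancedness; its elements are cosets.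
\<close>

definition tensor_relators ::
    "('k, 'r) module \<Rightarrow> ('l, 'r, 'm) bimodule \<Rightarrow> ('r, 't, 'n) bimodule \<Rightarrow> ('m \<times> 'n \<Rightarrow>\<^sub>0 int) set" where
  "tensor_relators R M N =
     {frag_of (m \<oplus>\<^bsub>M\<^esub> m', n) - (frag_of (m, n) + frag_of (m', n)) | m m' n.
        m \<in> carrier M \<and> m' \<in> carrier M \<and> n \<in> carrier N} \<union>
     {frag_of (m, n \<oplus>\<^bsub>N\<^esub> n') - (frag_of (m, n) + frag_of (m, n')) | m n n'.
        m \<in> carrier M \<and> n \<in> carrier N \<and> n' \<in> carrier N} \<union>
     {frag_of (m \<leftharpoonup>\<^bsub>M\<^esub> r, n) - frag_of (m, r \<rightharpoonup>\<^bsub>N\<^esub> n) | m r n.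
        m \<in> carrier M \<and> r \<in> carrier R \<and> n \<in> carrier N}"

definition tensor_subgroup ::
    "('k, 'r) module \<Rightarrow> ('l, 'r, 'm) bimodule \<Rightarrow> ('r, 't, 'n) bimodule \<Rightarrow> ('m \<times> 'n \<Rightarrow>\<^sub>0 int) set" where
  "tensor_subgroup R M N =
     generate (free_Abelian_group (carrier M \<times> carrier N)) (tensor_relators R M N)"

definition tensor_group ::
    "('k, 'r) module \<Rightarrow> ('l, 'r, 'm) bimodule \<Rightarrow> ('r, 't, 'n) bimodule \<Rightarrow>
      ('m \<times> 'n \<Rightarrow>\<^sub>0 int) set monoid" where
  "tensor_group R M N =
     free_Abelian_group (carrier M \<times> carrier N) Mod tensor_subgroup R M N"

definition tensor_elt ::
    "('k, 'r) module \<Rightarrow> ('l, 'r, 'm) bimodule \<Rightarrow> ('r, 't, 'n) bimodule \<Rightarrow>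
      'm \<Rightarrow> 'n \<Rightarrow> ('m \<times> 'n \<Rightarrow>\<^sub>0 int) set" where
  "tensor_elt R M N m n =
     tensor_subgroup R M N #>\<^bsub>free_Abelian_group (carrier M \<times> carrier N)\<^esub> frag_of (m, n)"

text \<open>
  The homomorphism out of a tensor product into the (multiplicatively written) abelian group \<open>G\<close>
  induced by a balanced map \<open>h\<close>: the homomorphism from the free abelian group that extends \<open>h\<close> is
  constant on each coset, and \<^const>\<open>the_elem\<close> selects the common value.
\<close>

definition tensor_lift ::
    "('g, 'z) monoid_scheme \<Rightarrow> ('m \<Rightarrow> 'n \<Rightarrow> 'g) \<Rightarrow> ('m \<times> 'n \<Rightarrow>\<^sub>0 int) set \<Rightarrow> 'g" where
  "tensor_lift G h t =
     the_elem ((\<lambda>x. \<Otimes>\<^bsub>G\<^esub>p\<in>Poly_Mapping.keys x.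
        h (fst p) (snd p) [^]\<^bsub>G\<^esub> Poly_Mapping.lookup x p) ` t)"

definition tensor ::
    "('k, 'r) module \<Rightarrow> ('l, 'r, 'm) bimodule \<Rightarrow> ('r, 't, 'n) bimodule \<Rightarrow>
      ('l, 't, ('m \<times> 'n \<Rightarrow>\<^sub>0 int) set) bimodule" where
  "tensor R M N =
     \<lparr>carrier = carrier (tensor_group R M N),
      monoid.mult = undefined, one = undefined,
      zero = one (tensor_group R M N),
      add = monoid.mult (tensor_group R M N),
      lsmult = (\<lambda>a. tensor_lift (tensor_group R M N) (\<lambda>m n. tensor_elt R M N (a \<rightharpoonup>\<^bsub>M\<^esub> m) n)),
      rsmult = (\<lambda>t b. tensor_lift (tensor_group R M N) (\<lambda>m n. tensor_elt R M N m (n \<leftharpoonup>\<^bsub>N\<^esub> b)) t)\<rparr>"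

definition tensor_map ::
    "('k, 'r) module \<Rightarrow> ('l, 'r, 'm1) bimodule \<Rightarrow> ('r, 't, 'n1) bimodule \<Rightarrow>
      ('m \<Rightarrow> 'm1) \<Rightarrow> ('n \<Rightarrow> 'n1) \<Rightarrow>
      ('m \<times> 'n \<Rightarrow>\<^sub>0 int) set \<Rightarrow> ('m1 \<times> 'n1 \<Rightarrow>\<^sub>0 int) set" where
  "tensor_map R M1 N1 f g =
     tensor_lift (tensor_group R M1 N1) (\<lambda>m n. tensor_elt R M1 N1 (f m) (g n))"

text \<open>
  The usual identifications \<open>(M \<otimes>\<^sub>R N) \<otimes>\<^sub>S P \<cong> M \<otimes>\<^sub>R (N \<otimes>\<^sub>S P)\<close>, \<open>R \<otimes>\<^sub>R M \<cong> M\<close> and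
  \<open>M \<otimes>\<^sub>R R \<cong> M\<close>.
\<close>

definition tensor_assoc ::
    "('k, 'r) module \<Rightarrow> ('k, 's) module \<Rightarrow>
      ('l, 'r, 'm) bimodule \<Rightarrow> ('r, 's, 'n) bimodule \<Rightarrow> ('s, 't, 'p) bimodule \<Rightarrow>
      (('m \<times> 'n \<Rightarrow>\<^sub>0 int) set \<times> 'p \<Rightarrow>\<^sub>0 int) set \<Rightarrow> ('m \<times> ('n \<times> 'p \<Rightarrow>\<^sub>0 int) set \<Rightarrow>\<^sub>0 int) set" where
  "tensor_assoc R S M N P =
     tensor_lift (tensor_group R M (tensor S N P))
       (\<lambda>t p. tensor_lift (tensor_group R M (tensor S N P))
          (\<lambda>m n. tensor_elt R M (tensor S N P) m (tensor_elt S N P n p)) t)"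

definition tensor_lunit :: "('l, 'r, 'm) bimodule \<Rightarrow> ('l \<times> 'm \<Rightarrow>\<^sub>0 int) set \<Rightarrow> 'm" where
  "tensor_lunit M = tensor_lift (add_monoid M) (\<lambda>a m. a \<rightharpoonup>\<^bsub>M\<^esub> m)"

definition tensor_runit :: "('l, 'r, 'm) bimodule \<Rightarrow> ('m \<times> 'r \<Rightarrow>\<^sub>0 int) set \<Rightarrow> 'm" where
  "tensor_runit M = tensor_lift (add_monoid M) (\<lambda>m a. m \<leftharpoonup>\<^bsub>M\<^esub> a)"


subsection \<open>Corings and dual rings\<close>

locale coring = bimodule K A A C
  for K :: "('k, 'z) ring_scheme" and A :: "('k, 'a) module" and C :: "('a, 'a, 'c) bimodule"
    and \<Delta> :: "'c \<Rightarrow> ('c \<times> 'c \<Rightarrow>\<^sub>0 int) set" and \<epsilon> :: "'c \<Rightarrow> 'a" +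
  assumes comult_hom: "\<Delta> \<in> bimodule_hom A A C (tensor A C C)"
    and counit_hom: "\<epsilon> \<in> bimodule_hom A A C (regular_bimodule A)"
    and coassoc:
      "c \<in> carrier C \<Longrightarrow>
         tensor_map A C (tensor A C C) id \<Delta> (\<Delta> c) =
         tensor_assoc A A C C C (tensor_map A (tensor A C C) C \<Delta> id (\<Delta> c))"
    and counit_left:
      "c \<in> carrier C \<Longrightarrow>
         tensor_lunit C (tensor_map A (regular_bimodule A) C \<epsilon> id (\<Delta> c)) = c"
    and counit_right:
      "c \<in> carrier C \<Longrightarrow>
         tensor_runit C (tensor_map A C (regular_bimodule A) id \<epsilon> (\<Delta> c)) = c"

definition left_dual ::
    "('k, 'a) module \<Rightarrow> ('a, 'a, 'c) bimodule \<Rightarrow>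
      ('c \<Rightarrow> ('c \<times> 'c \<Rightarrow>\<^sub>0 int) set) \<Rightarrow> ('c \<Rightarrow> 'a) \<Rightarrow> ('k, 'c \<Rightarrow> 'a) module" where
  "left_dual A C \<Delta> \<epsilon> =
     \<lparr>carrier = hom_left A C (regular_bimodule A),
      monoid.mult = (\<lambda>f g. \<lambda>c\<in>carrier C.
        f (tensor_runit C (tensor_map A C (regular_bimodule A) id g (\<Delta> c)))),
      one = restrict \<epsilon> (carrier C),
      zero = (\<lambda>c\<in>carrier C. \<zero>\<^bsub>A\<^esub>),
      add = (\<lambda>f g. \<lambda>c\<in>carrier C. f c \<oplus>\<^bsub>A\<^esub> g c),
      smult = (\<lambda>k f. \<lambda>c\<in>carrier C. k \<odot>\<^bsub>A\<^esub> f c)\<rparr>"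

text \<open>Left linear endomorphisms are multiplied in the order opposite to composition.\<close>

definition end_left :: "('k, 'b) module \<Rightarrow> ('b, 'a, 's) bimodule \<Rightarrow> ('k, 's \<Rightarrow> 's) module" where
  "end_left B M =
     \<lparr>carrier = hom_left B M M,
      monoid.mult = (\<lambda>f g. compose (carrier M) g f),
      one = (\<lambda>u\<in>carrier M. u),
      zero = (\<lambda>u\<in>carrier M. \<zero>\<^bsub>M\<^esub>),
      add = (\<lambda>f g. \<lambda>u\<in>carrier M. f u \<oplus>\<^bsub>M\<^esub> g u),
      smult = (\<lambda>k f. \<lambda>u\<in>carrier M. (k \<odot>\<^bsub>B\<^esub> \<one>\<^bsub>B\<^esub>) \<rightharpoonup>\<^bsub>M\<^esub> f u)\<rparr>"

definition algebra_anti_iso ::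
    "'k ring \<Rightarrow> ('k, 'a) module \<Rightarrow> ('k, 'b) module \<Rightarrow> ('a \<Rightarrow> 'b) set" where
  "algebra_anti_iso K R S =
     {h \<in> ring_iso R (S\<lparr>monoid.mult := \<lambda>x y. y \<otimes>\<^bsub>S\<^esub> x\<rparr>).
        \<forall>k\<in>carrier K. \<forall>x\<in>carrier R. h (k \<odot>\<^bsub>R\<^esub> x) = k \<odot>\<^bsub>S\<^esub> h x}"

end

theory Submission
  imports Defs
begin

text \<open>
  Additive maps out of a tensor product are determined by their values on the elements
  \<open>\<phi> \<otimes> u\<close>, so every coring axiom reduces to an identity between finite sums. The dual basis
  enters through \<open>u = \<Sum>\<^sub>i e\<^sub>i e\<^sub>i\<^sup>*(u)\<close> and \<open>\<phi> = \<Sum>\<^sub>i \<phi>(e\<^sub>i) e\<^sub>i\<^sup>*\<close>. The comultiplication is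
  well defined because \<open>b e\<^sub>i = \<Sum>\<^sub>j e\<^sub>j a\<^sub>j\<^sub>i\<close> and \<open>e\<^sub>j\<^sup>* b = \<Sum>\<^sub>i a\<^sub>j\<^sub>i e\<^sub>i\<^sup>*\<close> hold with the same
  coefficients \<open>a\<^sub>j\<^sub>i = e\<^sub>j\<^sup>*(b e\<^sub>i)\<close>. A left linear \<open>f\<close> on the coring corresponds to the unique
  endomorphism \<open>F\<close> with \<open>\<phi>(F u) = f(\<phi> \<otimes> u)\<close> for all \<open>\<phi>\<close> and \<open>u\<close>; since \<open>\<Sigma>\<^sup>*\<close> separates the points
  of \<open>\<Sigma>\<close>, all properties of \<open>f \<mapsto> F\<close>, and then the algebra axioms for the left dual, can be
  read off this equation.
\<close>

subsection \<open>Additive maps\<close>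

text \<open>A \<open>tensor_lift\<close> is \<open>the_elem\<close> of the image of a coset and
  means nothing until the map it extends is known to be balanced. Hence every map out of a tensor
  product, including both scalar actions on the product itself, comes with a balancedness proof that
  yields two facts, additivity and the value on pure tensors; later arguments use only these.
  Additive maps are homomorphisms between additive monoids, so they compose freely, and linearity
  over a ring is stated separately where it matters. The reversal of products has a simple source.
  If \<open>f\<close> and \<open>g\<close> correspond to \<open>F\<close> and \<open>G\<close>, then
  the convolution of \<open>f\<close> and \<open>g\<close> sends \<open>\<phi> \<otimes> u\<close>
  to \<open>f(\<phi> \<otimes> G u) = \<phi>(F(G u))\<close>. It corresponds to \<open>F\<close>
  after \<open>G\<close>, which in the ring opposite to composition is the product of
  \<open>G\<close> with \<open>F\<close>, in this order. Associativity of convolution is not derived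
  from coassociativity; it is pulled back from the endomorphism ring along the bijection.\<close>

abbreviation add_hom :: "('a, 'x) ring_scheme \<Rightarrow> ('b, 'y) ring_scheme \<Rightarrow> ('a \<Rightarrow> 'b) set" where
  "add_hom M N \<equiv> hom (add_monoid M) (add_monoid N)"

lemma add_homI:
  assumes "\<And>x. x \<in> carrier M \<Longrightarrow> f x \<in> carrier N"
    and "\<And>x y. \<lbrakk>x \<in> carrier M; y \<in> carrier M\<rbrakk> \<Longrightarrow> f (x \<oplus>\<^bsub>M\<^esub> y) = f x \<oplus>\<^bsub>N\<^esub> f y"
  shows "f \<in> add_hom M N"
  using assms by (auto simp: hom_def)

lemma add_hom_closed: "\<lbrakk>f \<in> add_hom M N; x \<in> carrier M\<rbrakk> \<Longrightarrow> f x \<in> carrier N"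
  by (auto simp: hom_def)

lemma add_hom_add:
  "\<lbrakk>f \<in> add_hom M N; x \<in> carrier M; y \<in> carrier M\<rbrakk> \<Longrightarrow> f (x \<oplus>\<^bsub>M\<^esub> y) = f x \<oplus>\<^bsub>N\<^esub> f y"
  by (auto simp: hom_def)

lemma add_hom_zero:
  assumes "abelian_group M" "abelian_group N" "f \<in> add_hom M N"
  shows "f \<zero>\<^bsub>M\<^esub> = \<zero>\<^bsub>N\<^esub>"
  using hom_one[OF assms(3)] abelian_group.a_group[OF assms(1)] abelian_group.a_group[OF assms(2)]
  by simp

lemma add_hom_compose:
  "\<lbrakk>f \<in> add_hom M N; g \<in> add_hom N P\<rbrakk> \<Longrightarrow> (\<lambda>x. g (f x)) \<in> add_hom M P"
  by (rule add_homI) (simp_all add: add_hom_closed add_hom_add)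

lemma add_hom_finsum:
  assumes "abelian_group M" "abelian_group N" "f \<in> add_hom M N" "finite I" "x \<in> I \<rightarrow> carrier M"
  shows "f (\<Oplus>\<^bsub>M\<^esub>i\<in>I. x i) = (\<Oplus>\<^bsub>N\<^esub>i\<in>I. f (x i))"
proof -
  interpret M: abelian_group M by fact
  interpret N: abelian_group N by fact
  note cl = add_hom_closed[OF assms(3)]
  show ?thesis
    using assms(4,5)
  proof (induction I)
    case empty
    then show ?case using add_hom_zero[OF assms(1-3)] by simp
  next
    case (insert i I)
    then have x: "x \<in> I \<rightarrow> carrier M" "x i \<in> carrier M" by auto
    then have "(\<lambda>j. f (x j)) \<in> I \<rightarrow> carrier N" "f (x i) \<in> carrier N" using cl by auto
    then show ?case
      using insert x by (simp add: add_hom_add[OF assms(3)])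
  qed
qed

lemma (in abelian_group) finsum_add_hom:
  assumes "finite I" "\<And>i. i \<in> I \<Longrightarrow> f i \<in> add_hom M G"
  shows "(\<lambda>x. \<Oplus>i\<in>I. f i x) \<in> add_hom M G"
proof (rule add_homI)
  fix x y assume xy: "x \<in> carrier M" "y \<in> carrier M"
  then show "(\<Oplus>i\<in>I. f i x) \<in> carrier G"
    using assms by (auto intro!: finsum_closed dest: add_hom_closed)
  have "(\<Oplus>i\<in>I. f i (x \<oplus>\<^bsub>M\<^esub> y)) = (\<Oplus>i\<in>I. f i x \<oplus> f i y)"
    using assms xy by (intro finsum_cong') (auto simp: add_hom_add dest: add_hom_closed)
  also have "\<dots> = (\<Oplus>i\<in>I. f i x) \<oplus> (\<Oplus>i\<in>I. f i y)"
    using assms xy by (intro finsum_addf) (auto dest: add_hom_closed)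
  finally show "(\<Oplus>i\<in>I. f i (x \<oplus>\<^bsub>M\<^esub> y)) = (\<Oplus>i\<in>I. f i x) \<oplus> (\<Oplus>i\<in>I. f i y)" .
qed

text \<open>Double sums over the dual basis are compared by exchanging the indices, once for the
  well-definedness of the comultiplication and once for coassociativity.\<close>

lemma (in abelian_group) finsum_swap:
  assumes "finite I" "finite J" "\<And>i j. \<lbrakk>i \<in> I; j \<in> J\<rbrakk> \<Longrightarrow> f i j \<in> carrier G"
  shows "(\<Oplus>i\<in>I. \<Oplus>j\<in>J. f i j) = (\<Oplus>j\<in>J. \<Oplus>i\<in>I. f i j)"
  using assms(1,3)
proof (induction I)
  case empty
  then show ?case by simp
next
  case (insert i I)
  then have "(\<lambda>j. \<Oplus>i\<in>I. f i j) \<in> J \<rightarrow> carrier G" "(\<lambda>j. f i j) \<in> J \<rightarrow> carrier G"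
    "(\<lambda>i. \<Oplus>j\<in>J. f i j) \<in> I \<rightarrow> carrier G" "(\<Oplus>j\<in>J. f i j) \<in> carrier G"
    by (auto intro!: finsum_closed)
  moreover have "(\<Oplus>j\<in>J. \<Oplus>i\<in>insert i I. f i j) = (\<Oplus>j\<in>J. f i j \<oplus> (\<Oplus>i\<in>I. f i j))"
    using insert by (intro finsum_cong') (auto intro!: finsum_closed)
  ultimately show ?case
    using insert by (simp add: finsum_addf)
qed

text \<open>Serves both the right dual and the endomorphism ring. Extensionality turns pointwise
  identities in \<open>G\<close> into equations of functions, and closure under pointwise negation
  supplies the inverses.\<close>

lemma abelian_group_pointwise:
  fixes M (structure)
  assumes "abelian_group G"
    and "carrier M \<subseteq> S \<rightarrow>\<^sub>E carrier G"
    and zero: "\<zero> = (\<lambda>u\<in>S. \<zero>\<^bsub>G\<^esub>)" and add: "\<And>f g. f \<oplus> g = (\<lambda>u\<in>S. f u \<oplus>\<^bsub>G\<^esub> g u)"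
    and "\<zero> \<in> carrier M"
    and "\<And>f g. \<lbrakk>f \<in> carrier M; g \<in> carrier M\<rbrakk> \<Longrightarrow> f \<oplus> g \<in> carrier M"
    and minus: "\<And>f. f \<in> carrier M \<Longrightarrow> (\<lambda>u\<in>S. \<ominus>\<^bsub>G\<^esub> f u) \<in> carrier M"
  shows "abelian_group M"
proof -
  interpret G: abelian_group G by fact
  have cl: "f u \<in> carrier G" if "f \<in> carrier M" "u \<in> S" for f u
    using assms(2) that by auto
  have ext: "f \<in> extensional S" if "f \<in> carrier M" for f
    using assms(2) that by (auto simp: PiE_def)
  show ?thesis
  proof (rule abelian_groupI)
    fix f assume f: "f \<in> carrier M"
    show "\<zero> \<oplus> f = f"
      unfolding zero add using f by (intro extensionalityI[OF _ ext]) (auto simp: cl)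
    have "(\<lambda>u\<in>S. \<ominus>\<^bsub>G\<^esub> f u) \<oplus> f = \<zero>"
      unfolding zero add using f by (intro extensionalityI[where A = S]) (auto simp: cl G.l_neg)
    then show "\<exists>g\<in>carrier M. g \<oplus> f = \<zero>"
      using minus[OF f] by blast
  next
    fix f g h assume "f \<in> carrier M" "g \<in> carrier M" "h \<in> carrier M"
    then show "f \<oplus> g \<oplus> h = f \<oplus> (g \<oplus> h)"
      unfolding add by (intro extensionalityI[where A = S]) (auto simp: cl G.a_assoc)
  next
    fix f g assume "f \<in> carrier M" "g \<in> carrier M"
    then show "f \<oplus> g = g \<oplus> f"
      unfolding add by (intro extensionalityI[where A = S]) (auto simp: cl G.a_comm)
  qed fact+
qed


subsection \<open>The universal property of the tensor product\<close>

text \<open>The product over the support of \<open>x\<close> is unchanged on any finite superset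
  inside \<open>S\<close>, since a zero exponent contributes the neutral element. This makes the
  products for \<open>x\<close>, \<open>y\<close> and \<open>x + y\<close> comparable although their
  supports differ.\<close>

lemma (in comm_group) free_Abelian_group_lift:
  fixes f :: "'c \<Rightarrow> 'a"
  assumes f: "f \<in> S \<rightarrow> carrier G"
  defines "F \<equiv> \<lambda>x. \<Otimes>p\<in>Poly_Mapping.keys x. f p [^] Poly_Mapping.lookup x p"
  shows "F \<in> hom (free_Abelian_group S) G" "\<And>p. p \<in> S \<Longrightarrow> F (frag_of p) = f p"
proof -
  have pw: "f p [^] (n::int) \<in> carrier G" if "p \<in> S" for p n
    using f that by auto
  have ext: "F x = (\<Otimes>p\<in>W. f p [^] Poly_Mapping.lookup x p)"
    if "finite W" "Poly_Mapping.keys x \<subseteq> W" "W \<subseteq> S" for x W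
    unfolding F_def
  proof (rule finprod_mono_neutral_cong_left)
    show "f i [^] Poly_Mapping.lookup x i = \<one>" if "i \<in> W - Poly_Mapping.keys x" for i
      using that by (simp add: in_keys_iff)
  qed (use that pw in auto)
  show "F \<in> hom (free_Abelian_group S) G"
  proof (rule homI)
    fix x assume "x \<in> carrier (free_Abelian_group S)"
    then show "F x \<in> carrier G"
      unfolding F_def using pw by (intro finprod_closed) auto
    fix y assume "y \<in> carrier (free_Abelian_group S)"
    let ?W = "Poly_Mapping.keys x \<union> Poly_Mapping.keys y"
    have W: "finite ?W" "?W \<subseteq> S" "Poly_Mapping.keys (x + y) \<subseteq> ?W"
      using \<open>x \<in> _\<close> \<open>y \<in> _\<close> keys_add[of x y] by auto
    have "F (x + y) = (\<Otimes>p\<in>?W. f p [^] Poly_Mapping.lookup x p \<otimes> f p [^] Poly_Mapping.lookup y p)"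
      unfolding ext[OF W(1,3,2)]
      by (intro finprod_cong')
        (use f W in \<open>auto simp: Poly_Mapping.lookup_add int_pow_mult Pi_iff subset_iff\<close>)
    also have "\<dots> = F x \<otimes> F y"
      unfolding ext[OF W(1) Un_upper1 W(2)] ext[OF W(1) Un_upper2 W(2)]
      by (rule finprod_multf) (use W(2) pw in auto)
    finally show "F (x \<otimes>\<^bsub>free_Abelian_group S\<^esub> y) = F x \<otimes> F y" by simp
  qed
  show "F (frag_of p) = f p" if "p \<in> S" for p
  proof -
    have "f p \<in> carrier G" using f that by auto
    then show ?thesis by (simp add: F_def)
  qed
qed

text \<open>The target is a ring record of which only the additive group enters, so that a ring, a
  bimodule and a tensor product are all admissible targets.\<close>

definition balanced ::
    "('k, 'r) module \<Rightarrow> ('l, 'r, 'm) bimodule \<Rightarrow> ('r, 't, 'n) bimodule \<Rightarrow> ('g, 'z) ring_scheme \<Rightarrow>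
      ('m \<Rightarrow> 'n \<Rightarrow> 'g) \<Rightarrow> bool" where
  "balanced R M N G h \<longleftrightarrow>
     (\<forall>n\<in>carrier N. (\<lambda>m. h m n) \<in> add_hom M G) \<and>
     (\<forall>m\<in>carrier M. h m \<in> add_hom N G) \<and>
     (\<forall>m\<in>carrier M. \<forall>r\<in>carrier R. \<forall>n\<in>carrier N. h (m \<leftharpoonup>\<^bsub>M\<^esub> r) n = h m (r \<rightharpoonup>\<^bsub>N\<^esub> n))"

lemma balancedI:
  assumes "\<And>m n. \<lbrakk>m \<in> carrier M; n \<in> carrier N\<rbrakk> \<Longrightarrow> h m n \<in> carrier G"
    and "\<And>m m' n. \<lbrakk>m \<in> carrier M; m' \<in> carrier M; n \<in> carrier N\<rbrakk> \<Longrightarrow>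
      h (m \<oplus>\<^bsub>M\<^esub> m') n = h m n \<oplus>\<^bsub>G\<^esub> h m' n"
    and "\<And>m n n'. \<lbrakk>m \<in> carrier M; n \<in> carrier N; n' \<in> carrier N\<rbrakk> \<Longrightarrow>
      h m (n \<oplus>\<^bsub>N\<^esub> n') = h m n \<oplus>\<^bsub>G\<^esub> h m n'"
    and "\<And>m r n. \<lbrakk>m \<in> carrier M; r \<in> carrier R; n \<in> carrier N\<rbrakk> \<Longrightarrow>
      h (m \<leftharpoonup>\<^bsub>M\<^esub> r) n = h m (r \<rightharpoonup>\<^bsub>N\<^esub> n)"
  shows "balanced R M N G h"
  unfolding balanced_def using assms by (auto intro!: add_homI)

lemma tensor_simps:
  "carrier (tensor R M N) = carrier (tensor_group R M N)"
  "add (tensor R M N) = monoid.mult (tensor_group R M N)"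
  "\<zero>\<^bsub>tensor R M N\<^esub> = \<one>\<^bsub>tensor_group R M N\<^esub>"
  by (simp_all add: tensor_def)

section \<open>The tensor product as a quotient group, and its pure tensors\<close>

locale bimodule_pair = M: bimodule K L R M + N: bimodule K R T N
  for K :: "('k, 'z) ring_scheme" and L :: "('k, 'l) module" and R :: "('k, 'r) module"
    and T :: "('k, 't) module" and M :: "('l, 'r, 'm) bimodule" and N :: "('r, 't, 'n) bimodule"
begin

abbreviation "F \<equiv> free_Abelian_group (carrier M \<times> carrier N)"
abbreviation "X \<equiv> tensor R M N"
abbreviation "elt \<equiv> tensor_elt R M N"

lemma free_add_closed: "\<lbrakk>x \<in> carrier F; y \<in> carrier F\<rbrakk> \<Longrightarrow> x + y \<in> carrier F"
  using keys_add[of x y] by auto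

lemma free_diff_closed: "\<lbrakk>x \<in> carrier F; y \<in> carrier F\<rbrakk> \<Longrightarrow> x - y \<in> carrier F"
  using keys_diff[of x y] by auto

lemma frag_of_closed: "\<lbrakk>m \<in> carrier M; n \<in> carrier N\<rbrakk> \<Longrightarrow> frag_of (m, n) \<in> carrier F"
  by simp

lemmas free_closed = free_add_closed free_diff_closed frag_of_closed

lemma tensor_relators_subset: "tensor_relators R M N \<subseteq> carrier F"
  unfolding tensor_relators_def
  by (auto simp del: carrier_free_Abelian_group_iff
    intro!: free_closed M.rsmult_closed N.lsmult_closed M.a_closed N.a_closed)

lemma tensor_subgroup_normal: "tensor_subgroup R M N \<lhd> F"
  unfolding tensor_subgroup_def
  using comm_group.normal_iff_subgroup[OF abelian_free_Abelian_group]
    group.generate_is_subgroup[OF group_free_Abelian_group tensor_relators_subset] by blast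

lemma tensor_comm_group: "comm_group (tensor_group R M N)"
  unfolding tensor_group_def
  using comm_group.abelian_FactGroup[OF abelian_free_Abelian_group]
    tensor_subgroup_normal normal_imp_subgroup by blast

lemma tensor_abelian_group: "abelian_group X"
proof -
  interpret G: comm_group "tensor_group R M N" by (rule tensor_comm_group)
  show ?thesis
    by (rule abelian_groupI) (auto simp: tensor_simps G.m_ac intro: G.l_inv_ex)
qed

sublocale X: abelian_group X by (rule tensor_abelian_group)

abbreviation "coset \<equiv> r_coset F (tensor_subgroup R M N)"

lemma tensor_carrier: "carrier X = coset ` carrier F"
  by (simp add: tensor_def tensor_group_def carrier_FactGroup)

lemma coset_closed: "x \<in> carrier F \<Longrightarrow> coset x \<in> carrier X"
  by (simp only: tensor_carrier imageI)

lemma coset_add: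
  assumes "x \<in> carrier F" "y \<in> carrier F"
  shows "coset (x + y) = coset x \<oplus>\<^bsub>X\<^esub> coset y"
  using normal.rcos_sum[OF tensor_subgroup_normal assms]
  by (simp add: tensor_def tensor_group_def)

lemma coset_hom: "coset \<in> hom F (add_monoid X)"
  by (rule homI) (use tensor_carrier coset_add in auto)

lemma coset_relator:
  assumes "x \<in> tensor_relators R M N"
  shows "coset x = \<zero>\<^bsub>X\<^esub>"
proof -
  have "x \<in> tensor_subgroup R M N"
    unfolding tensor_subgroup_def using assms by (rule generate.incl)
  then have "coset x = tensor_subgroup R M N"
    using group.coset_join2[OF group_free_Abelian_group] tensor_subgroup_normal
      normal_imp_subgroup assms tensor_relators_subset by blast
  then show ?thesis by (simp add: tensor_def tensor_group_def)
qed

text \<open>Every relator is a difference, so this is the form in which the defining relations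
  become equations between pure tensors.\<close>

lemma coset_diff:
  assumes "x - y \<in> tensor_relators R M N" "x \<in> carrier F" "y \<in> carrier F"
  shows "coset x = coset y"
proof -
  have "coset x = coset ((x - y) + y)" by simp
  also have "\<dots> = coset (x - y) \<oplus>\<^bsub>X\<^esub> coset y"
    using assms tensor_relators_subset by (intro coset_add) blast+
  also have "\<dots> = coset y"
    using assms coset_relator tensor_carrier by auto
  finally show ?thesis .
qed

lemma elt_closed: "\<lbrakk>m \<in> carrier M; n \<in> carrier N\<rbrakk> \<Longrightarrow> elt m n \<in> carrier X"
  unfolding tensor_carrier tensor_elt_def by auto

lemma elt_add_left:
  assumes "m \<in> carrier M" "m' \<in> carrier M" "n \<in> carrier N"
  shows "elt (m \<oplus>\<^bsub>M\<^esub> m') n = elt m n \<oplus>\<^bsub>X\<^esub> elt m' n"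
proof -
  have "coset (frag_of (m \<oplus>\<^bsub>M\<^esub> m', n)) = coset (frag_of (m, n) + frag_of (m', n))"
    using assms by (intro coset_diff free_closed M.a_closed N.a_closed) (auto simp: tensor_relators_def)
  then show ?thesis
    unfolding tensor_elt_def using assms by (simp add: coset_add)
qed

lemma elt_add_right:
  assumes "m \<in> carrier M" "n \<in> carrier N" "n' \<in> carrier N"
  shows "elt m (n \<oplus>\<^bsub>N\<^esub> n') = elt m n \<oplus>\<^bsub>X\<^esub> elt m n'"
proof -
  have "coset (frag_of (m, n \<oplus>\<^bsub>N\<^esub> n')) = coset (frag_of (m, n) + frag_of (m, n'))"
    using assms by (intro coset_diff free_closed M.a_closed N.a_closed) (auto simp: tensor_relators_def)
  then show ?thesis
    unfolding tensor_elt_def using assms by (simp add: coset_add)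
qed

lemma elt_smult:
  assumes "m \<in> carrier M" "r \<in> carrier R" "n \<in> carrier N"
  shows "elt (m \<leftharpoonup>\<^bsub>M\<^esub> r) n = elt m (r \<rightharpoonup>\<^bsub>N\<^esub> n)"
  unfolding tensor_elt_def using assms M.rsmult_closed N.lsmult_closed
  by (intro coset_diff) (auto simp: tensor_relators_def)

lemma balanced_elt: "balanced R M N X elt"
  by (intro balancedI elt_closed elt_add_left elt_add_right elt_smult)

lemma elt_hom_left: "n \<in> carrier N \<Longrightarrow> (\<lambda>m. elt m n) \<in> add_hom M X"
  and elt_hom_right: "m \<in> carrier M \<Longrightarrow> elt m \<in> add_hom N X"
  using balanced_elt by (auto simp: balanced_def)

text \<open>The negative of a pure tensor is again pure. Finite sums of pure tensors therefore
  already form a group, and induction over the tensor product needs no case for negatives.\<close>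

lemma elt_minus:
  assumes "m \<in> carrier M" "n \<in> carrier N"
  shows "\<ominus>\<^bsub>X\<^esub> elt m n = elt (\<ominus>\<^bsub>M\<^esub> m) n"
proof -
  have "elt (\<ominus>\<^bsub>M\<^esub> m) n \<oplus>\<^bsub>X\<^esub> elt m n = elt \<zero>\<^bsub>M\<^esub> n"
    using assms by (simp add: M.l_neg flip: elt_add_left)
  also have "\<dots> = \<zero>\<^bsub>X\<^esub>"
    using add_hom_zero[OF M.abelian_group_axioms X.abelian_group_axioms elt_hom_left[OF assms(2)]] .
  finally show ?thesis
    using assms by (intro X.minus_equality) (auto intro: elt_closed)
qed

lemma tensor_induct [consumes 1, case_names elt add]:
  assumes "t \<in> carrier X"
    and elt: "\<And>m n. \<lbrakk>m \<in> carrier M; n \<in> carrier N\<rbrakk> \<Longrightarrow> P (elt m n)"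
    and add: "\<And>s t. \<lbrakk>s \<in> carrier X; t \<in> carrier X; P s; P t\<rbrakk> \<Longrightarrow> P (s \<oplus>\<^bsub>X\<^esub> t)"
  shows "P t"
proof -
  obtain x where x: "Poly_Mapping.keys x \<subseteq> carrier M \<times> carrier N" and t: "t = coset x"
    using assms(1) tensor_carrier by auto
  have one: "coset 0 = \<zero>\<^bsub>X\<^esub>"
    using hom_one[OF coset_hom group_free_Abelian_group X.a_group] by simp
  have P0: "P \<zero>\<^bsub>X\<^esub>"
    using elt[of "\<zero>\<^bsub>M\<^esub>" "\<zero>\<^bsub>N\<^esub>"]
      add_hom_zero[OF M.abelian_group_axioms X.abelian_group_axioms elt_hom_left[of "\<zero>\<^bsub>N\<^esub>"]] by simp
  \<comment> \<open>The induction over the free abelian group has a case for differences, while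
    \<open>P\<close> is only known to respect sums. Carrying the negative along turns a difference
    into a sum.\<close>
  have "P (coset x) \<and> P (\<ominus>\<^bsub>X\<^esub> coset x)"
    using x
  proof (induction x rule: free_Abelian_group_induct[consumes 1])
    case 1
    then show ?case using P0 one X.add.inv_one by (simp add: a_inv_def)
  next
    case (2 x y)
    then have xy: "x \<in> carrier F" "y \<in> carrier F" by simp_all
    then have cl: "coset x \<in> carrier X" "coset y \<in> carrier X" "coset (x - y) \<in> carrier X"
      by (auto intro!: coset_closed simp del: carrier_free_Abelian_group_iff intro: free_closed)
    have "coset x = coset (x - y + y)" by simp
    also have "\<dots> = coset (x - y) \<oplus>\<^bsub>X\<^esub> coset y"
      using xy by (intro coset_add free_closed)
    finally have "coset (x - y) = coset x \<oplus>\<^bsub>X\<^esub> \<ominus>\<^bsub>X\<^esub> coset y"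
      using cl by (simp add: X.a_assoc X.r_neg)
    then show ?case
      using 2 cl by (simp add: X.minus_add add)
  next
    case (3 p)
    then show ?case
      using elt elt_minus by (auto simp: tensor_elt_def)
  qed
  then show ?thesis using t by simp
qed

text \<open>\<open>P\<close> is a multiplicative presentation of the additive group of
  \<open>G\<close>: it will be \<open>add_monoid G\<close> for a ring or bimodule and
  \<open>tensor_group\<close> for a tensor product. The extension of a balanced map to the free
  abelian group kills the relators and is therefore constant on cosets.\<close>

lemma tensor_lift:
  assumes "abelian_group G" and h: "balanced R M N G h"
    and P: "comm_group P" "carrier P = carrier G" "monoid.mult P = add G"
  shows tensor_lift_hom: "tensor_lift P h \<in> add_hom X G"
    and tensor_lift_elt: "\<And>m n. \<lbrakk>m \<in> carrier M; n \<in> carrier N\<rbrakk> \<Longrightarrow>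
      tensor_lift P h (elt m n) = h m n"
proof -
  interpret G: abelian_group G by fact
  interpret P: comm_group P by fact
  \<comment> \<open>Only the carrier and the multiplication of \<open>P\<close> are tied to
    \<open>G\<close>; the neutral elements then agree by uniqueness.\<close>
  have one: "\<one>\<^bsub>P\<^esub> = \<zero>\<^bsub>G\<^esub>"
    by (rule P.one_unique[symmetric]) (simp_all add: P(2,3))
  define H where "H = (\<lambda>x :: 'm \<times> 'n \<Rightarrow>\<^sub>0 int. \<Otimes>\<^bsub>P\<^esub>p\<in>Poly_Mapping.keys x.
    h (fst p) (snd p) [^]\<^bsub>P\<^esub> Poly_Mapping.lookup x p)"
  have hcl: "h m n \<in> carrier G" if "m \<in> carrier M" "n \<in> carrier N" for m n
    using h that by (auto simp: balanced_def dest: add_hom_closed)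
  have H_hom: "H \<in> hom F P"
    and H_frag: "\<And>m n. \<lbrakk>m \<in> carrier M; n \<in> carrier N\<rbrakk> \<Longrightarrow> H (frag_of (m, n)) = h m n"
  proof -
    have f: "(\<lambda>p. h (fst p) (snd p)) \<in> carrier M \<times> carrier N \<rightarrow> carrier P"
      using hcl P(2) by auto
    show "H \<in> hom F P"
      unfolding H_def by (rule comm_group.free_Abelian_group_lift(1)[OF P(1) f])
    show "H (frag_of (m, n)) = h m n" if "m \<in> carrier M" "n \<in> carrier N" for m n
      using comm_group.free_Abelian_group_lift(2)[OF P(1) f, of "(m, n)"] that unfolding H_def by simp
  qed
  interpret H: group_hom F "P" H
    using H_hom P.is_group by (simp add: group_hom_def group_hom_axioms_def)
  have Hadd: "H (x + y) = H x \<oplus>\<^bsub>G\<^esub> H y" if "x \<in> carrier F" "y \<in> carrier F" for x y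
    using H.hom_mult[OF that] by (simp add: P(3))
  \<comment> \<open>Matches the shape of the relators, each of which is a difference of two elements
    with the same value under \<open>H\<close>.\<close>
  have Hdiff: "H (x - y) = \<zero>\<^bsub>G\<^esub>" if "x \<in> carrier F" "y \<in> carrier F" "H x = H y" for x y
  proof -
    have "x - y \<in> carrier F" by (intro free_closed that)
    then have "H (x - y) \<oplus>\<^bsub>G\<^esub> H y = H y" "H (x - y) \<in> carrier G" "H y \<in> carrier G"
      using Hadd[of "x - y" y] that H.hom_closed P(2) by simp_all
    then show ?thesis by simp
  qed
  have "tensor_relators R M N \<subseteq> kernel F (P) H"
  proof
    fix x assume x: "x \<in> tensor_relators R M N"
    then have "H x = \<zero>\<^bsub>G\<^esub>"
      unfolding tensor_relators_def
    proof (elim UnE CollectE exE conjE, goal_cases)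
      case (1 m m' n)
      then show ?case
        unfolding 1(1) using h
        by (intro Hdiff free_closed M.a_closed)
          (simp_all add: H_frag Hadd balanced_def add_hom_add[of "\<lambda>m. h m n"])
    next
      case (2 m n n')
      then show ?case
        unfolding 2(1) using h
        by (intro Hdiff free_closed N.a_closed)
          (simp_all add: H_frag Hadd balanced_def add_hom_add[of "h m"])
    next
      case (3 m r n)
      then show ?case
        unfolding 3(1) using h
        by (intro Hdiff free_closed M.rsmult_closed N.lsmult_closed)
          (simp_all add: H_frag balanced_def M.rsmult_closed N.lsmult_closed)
    qed
    then show "x \<in> kernel F (P) H"
      using x tensor_relators_subset unfolding kernel_def one by blast
  qed
  then have ker: "tensor_subgroup R M N \<subseteq> kernel F (P) H"
    unfolding tensor_subgroup_def
    using group.generate_subgroup_incl[OF group_free_Abelian_group _ H.subgroup_kernel] by blast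
  have val: "tensor_lift P h (coset x) = H x" if "x \<in> carrier F" for x
  proof -
    have sub: "subgroup (tensor_subgroup R M N) F"
      using tensor_subgroup_normal normal_imp_subgroup by blast
    have "H y = H x" if "y \<in> coset x" for y
    proof -
      from that obtain s where "s \<in> tensor_subgroup R M N" "y = s + x"
        by (auto simp: r_coset_def)
      moreover have "s \<in> carrier F" "H s = \<zero>\<^bsub>G\<^esub>"
        using ker \<open>s \<in> _\<close> by (auto simp: kernel_def one)
      ultimately show ?thesis
        using Hadd[of s x] \<open>x \<in> carrier F\<close> H.hom_closed[of x] P(2) by auto
    qed
    moreover have "x \<in> coset x"
      by (rule group.rcos_self[OF group_free_Abelian_group that sub])
    \<comment> \<open>The image of a coset is a singleton, which is what gives
      \<open>the_elem\<close> in \<open>tensor_lift\<close> its value.\<close>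
    ultimately have "H ` coset x = {H x}" by blast
    then show ?thesis
      unfolding tensor_lift_def by (simp add: H_def)
  qed
  show "tensor_lift P h \<in> add_hom X G"
  proof (rule add_homI)
    fix s assume "s \<in> carrier X"
    then obtain x where x: "x \<in> carrier F" "s = coset x" using tensor_carrier by auto
    then show "tensor_lift P h s \<in> carrier G"
      using val H.hom_closed P(2) by auto
    fix t assume "t \<in> carrier X"
    then obtain y where y: "y \<in> carrier F" "t = coset y" using tensor_carrier by auto
    have "x + y \<in> carrier F" using x y by (intro free_closed)
    then show "tensor_lift P h (s \<oplus>\<^bsub>X\<^esub> t) =
        tensor_lift P h s \<oplus>\<^bsub>G\<^esub> tensor_lift P h t"
      using x y val Hadd by (simp flip: coset_add)
  qed
  show "tensor_lift P h (elt m n) = h m n" if "m \<in> carrier M" "n \<in> carrier N" for m n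
    unfolding tensor_elt_def using that val H_frag by simp
qed

lemma tensor_hom_eqI:
  assumes "f \<in> add_hom X G" "g \<in> add_hom X G"
    and "\<And>m n. \<lbrakk>m \<in> carrier M; n \<in> carrier N\<rbrakk> \<Longrightarrow> f (elt m n) = g (elt m n)"
    and "t \<in> carrier X"
  shows "f t = g t"
  using assms(4) by (induction rule: tensor_induct) (simp_all add: assms(3) add_hom_add[OF assms(1)] add_hom_add[OF assms(2)])

end

section \<open>The bimodule structure of the tensor product\<close>

context bimodule_pair
begin

lemma tensor_lift_add_monoid:
  assumes "abelian_group G" "balanced R M N G h"
  shows tensor_lift_add_monoid_hom: "tensor_lift (add_monoid G) h \<in> add_hom X G"
    and tensor_lift_add_monoid_elt: "\<And>m n. \<lbrakk>m \<in> carrier M; n \<in> carrier N\<rbrakk> \<Longrightarrow>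
      tensor_lift (add_monoid G) h (elt m n) = h m n"
  using tensor_lift[OF assms abelian_group.a_comm_group[OF assms(1)]] by simp_all

lemma tensor_lift_tensor_group:
  assumes "bimodule_pair K' L' R' T' M' N'" "balanced R M N (tensor R' M' N') h"
  shows tensor_lift_tensor_group_hom: "tensor_lift (tensor_group R' M' N') h \<in> add_hom X (tensor R' M' N')"
    and tensor_lift_tensor_group_elt: "\<And>m n. \<lbrakk>m \<in> carrier M; n \<in> carrier N\<rbrakk> \<Longrightarrow>
      tensor_lift (tensor_group R' M' N') h (elt m n) = h m n"
  using tensor_lift[OF bimodule_pair.tensor_abelian_group[OF assms(1)] assms(2)
      bimodule_pair.tensor_comm_group[OF assms(1)]]
  by (simp_all add: tensor_simps)

lemma lsmult_tensor: "a \<rightharpoonup>\<^bsub>X\<^esub> t = tensor_lift (tensor_group R M N) (\<lambda>m n. elt (a \<rightharpoonup>\<^bsub>M\<^esub> m) n) t"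
  and rsmult_tensor: "t \<leftharpoonup>\<^bsub>X\<^esub> b = tensor_lift (tensor_group R M N) (\<lambda>m n. elt m (n \<leftharpoonup>\<^bsub>N\<^esub> b)) t"
  by (simp_all add: tensor_def)

text \<open>Acting on the left factor respects balancing over \<open>R\<close> because the two
  actions on \<open>M\<close> commute. The mirror statement for the right factor rests on the
  commuting actions on \<open>N\<close>.\<close>

lemma
  assumes a: "a \<in> carrier L"
  shows lsmult_tensor_hom: "(\<lambda>t. a \<rightharpoonup>\<^bsub>X\<^esub> t) \<in> add_hom X X"
    and lsmult_elt: "\<And>m n. \<lbrakk>m \<in> carrier M; n \<in> carrier N\<rbrakk> \<Longrightarrow> a \<rightharpoonup>\<^bsub>X\<^esub> elt m n = elt (a \<rightharpoonup>\<^bsub>M\<^esub> m) n"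
proof -
  have "balanced R M N X (\<lambda>m n. elt (a \<rightharpoonup>\<^bsub>M\<^esub> m) n)"
    using a by (intro balancedI)
      (simp_all add: M.lsmult_closed elt_closed M.lsmult_r_distr elt_add_left elt_add_right
        elt_smult flip: M.lsmult_rsmult_assoc)
  note lift = tensor_lift_tensor_group[OF bimodule_pair_axioms this]
  show "(\<lambda>t. a \<rightharpoonup>\<^bsub>X\<^esub> t) \<in> add_hom X X" unfolding lsmult_tensor by (rule lift(1))
  show "\<lbrakk>m \<in> carrier M; n \<in> carrier N\<rbrakk> \<Longrightarrow> a \<rightharpoonup>\<^bsub>X\<^esub> elt m n = elt (a \<rightharpoonup>\<^bsub>M\<^esub> m) n" for m n
    unfolding lsmult_tensor by (rule lift(2))
qed

lemma
  assumes b: "b \<in> carrier T"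
  shows rsmult_tensor_hom: "(\<lambda>t. t \<leftharpoonup>\<^bsub>X\<^esub> b) \<in> add_hom X X"
    and rsmult_elt: "\<And>m n. \<lbrakk>m \<in> carrier M; n \<in> carrier N\<rbrakk> \<Longrightarrow> elt m n \<leftharpoonup>\<^bsub>X\<^esub> b = elt m (n \<leftharpoonup>\<^bsub>N\<^esub> b)"
proof -
  have "balanced R M N X (\<lambda>m n. elt m (n \<leftharpoonup>\<^bsub>N\<^esub> b))"
    using b by (intro balancedI)
      (simp_all add: N.rsmult_closed elt_closed N.rsmult_l_distr elt_add_left elt_add_right
        elt_smult N.lsmult_rsmult_assoc)
  note lift = tensor_lift_tensor_group[OF bimodule_pair_axioms this]
  show "(\<lambda>t. t \<leftharpoonup>\<^bsub>X\<^esub> b) \<in> add_hom X X" unfolding rsmult_tensor by (rule lift(1))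
  show "\<lbrakk>m \<in> carrier M; n \<in> carrier N\<rbrakk> \<Longrightarrow> elt m n \<leftharpoonup>\<^bsub>X\<^esub> b = elt m (n \<leftharpoonup>\<^bsub>N\<^esub> b)" for m n
    unfolding rsmult_tensor by (rule lift(2))
qed

lemma tensor_bimodule: "bimodule K L T X"
proof -
  note cl = elt_closed M.lsmult_closed N.rsmult_closed
    add_hom_closed[OF lsmult_tensor_hom] add_hom_closed[OF rsmult_tensor_hom]
  note add = add_hom_add[OF lsmult_tensor_hom] add_hom_add[OF rsmult_tensor_hom]
  note simps = cl add lsmult_elt rsmult_elt
  show ?thesis
  proof (intro bimodule.intro bimodule_axioms.intro)
    show "assoc_algebra K L" "assoc_algebra K T" "abelian_group X"
      by unfold_locales
    show "a \<rightharpoonup>\<^bsub>X\<^esub> t \<in> carrier X" if "a \<in> carrier L" "t \<in> carrier X" for a t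
      using that by (simp add: cl)
    show "t \<leftharpoonup>\<^bsub>X\<^esub> a \<in> carrier X" if "a \<in> carrier T" "t \<in> carrier X" for a t
      using that by (simp add: cl)
    show "a \<rightharpoonup>\<^bsub>X\<^esub> (s \<oplus>\<^bsub>X\<^esub> t) = a \<rightharpoonup>\<^bsub>X\<^esub> s \<oplus>\<^bsub>X\<^esub> a \<rightharpoonup>\<^bsub>X\<^esub> t"
      if "a \<in> carrier L" "s \<in> carrier X" "t \<in> carrier X" for a s t
      using that by (simp add: add)
    show "(s \<oplus>\<^bsub>X\<^esub> t) \<leftharpoonup>\<^bsub>X\<^esub> a = s \<leftharpoonup>\<^bsub>X\<^esub> a \<oplus>\<^bsub>X\<^esub> t \<leftharpoonup>\<^bsub>X\<^esub> a"
      if "s \<in> carrier X" "t \<in> carrier X" "a \<in> carrier T" for a s t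
      using that by (simp add: add)
    \<comment> \<open>Closure and additivity of each action come directly from the lift. The
      remaining laws compare different scalars, so they are checked on pure tensors and extended by
      induction.\<close>
    fix t assume t: "t \<in> carrier X"
    show "(a \<oplus>\<^bsub>L\<^esub> b) \<rightharpoonup>\<^bsub>X\<^esub> t = a \<rightharpoonup>\<^bsub>X\<^esub> t \<oplus>\<^bsub>X\<^esub> b \<rightharpoonup>\<^bsub>X\<^esub> t" if "a \<in> carrier L" "b \<in> carrier L" for a b
      using t that
      by (induction rule: tensor_induct) (simp_all add: simps M.lsmult_l_distr elt_add_left X.a_ac)
    show "t \<leftharpoonup>\<^bsub>X\<^esub> (a \<oplus>\<^bsub>T\<^esub> b) = t \<leftharpoonup>\<^bsub>X\<^esub> a \<oplus>\<^bsub>X\<^esub> t \<leftharpoonup>\<^bsub>X\<^esub> b" if "a \<in> carrier T" "b \<in> carrier T" for a b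
      using t that
      by (induction rule: tensor_induct) (simp_all add: simps N.rsmult_r_distr elt_add_right X.a_ac)
    show "(a \<otimes>\<^bsub>L\<^esub> b) \<rightharpoonup>\<^bsub>X\<^esub> t = a \<rightharpoonup>\<^bsub>X\<^esub> (b \<rightharpoonup>\<^bsub>X\<^esub> t)" if "a \<in> carrier L" "b \<in> carrier L" for a b
      using t that by (induction rule: tensor_induct) (simp_all add: simps M.lsmult_assoc)
    show "t \<leftharpoonup>\<^bsub>X\<^esub> (a \<otimes>\<^bsub>T\<^esub> b) = t \<leftharpoonup>\<^bsub>X\<^esub> a \<leftharpoonup>\<^bsub>X\<^esub> b" if "a \<in> carrier T" "b \<in> carrier T" for a b
      using t that by (induction rule: tensor_induct) (simp_all add: simps N.rsmult_assoc)
    show "\<one>\<^bsub>L\<^esub> \<rightharpoonup>\<^bsub>X\<^esub> t = t"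
      using t by (induction rule: tensor_induct) (simp_all add: simps M.lsmult_one)
    show "t \<leftharpoonup>\<^bsub>X\<^esub> \<one>\<^bsub>T\<^esub> = t"
      using t by (induction rule: tensor_induct) (simp_all add: simps N.rsmult_one)
    show "(a \<rightharpoonup>\<^bsub>X\<^esub> t) \<leftharpoonup>\<^bsub>X\<^esub> b = a \<rightharpoonup>\<^bsub>X\<^esub> (t \<leftharpoonup>\<^bsub>X\<^esub> b)" if "a \<in> carrier L" "b \<in> carrier T" for a b
      using t that by (induction rule: tensor_induct) (simp_all add: simps)
    \<comment> \<open>The scalar is carried from the left of \<open>M\<close> to its right, across
      the tensor sign to the left of \<open>N\<close>, and from there to the right of
      \<open>N\<close>.\<close>
    show "(k \<odot>\<^bsub>L\<^esub> \<one>\<^bsub>L\<^esub>) \<rightharpoonup>\<^bsub>X\<^esub> t = t \<leftharpoonup>\<^bsub>X\<^esub> (k \<odot>\<^bsub>T\<^esub> \<one>\<^bsub>T\<^esub>)" if k: "k \<in> carrier K" for k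
      using t
    proof (induction rule: tensor_induct)
      case (elt m n)
      then show ?case
        using k by (simp add: simps M.centralizes elt_smult flip: N.centralizes)
    qed (use k in \<open>simp add: simps\<close>)
  qed
qed

end

lemma bimodule_pairI: "\<lbrakk>bimodule K L R M; bimodule K R T N\<rbrakk> \<Longrightarrow> bimodule_pair K L R T M N"
  by (simp add: bimodule_pair_def)

lemma bimodule_tensor:
  "\<lbrakk>bimodule K L R M; bimodule K R T N\<rbrakk> \<Longrightarrow> bimodule K L T (tensor R M N)"
  by (rule bimodule_pair.tensor_bimodule) (rule bimodule_pairI)

section \<open>The regular bimodule, and maps between tensor products\<close>

lemma regular_bimodule_simps [simp]:
  "carrier (regular_bimodule A) = carrier A"
  "\<zero>\<^bsub>regular_bimodule A\<^esub> = \<zero>\<^bsub>A\<^esub>"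
  "x \<oplus>\<^bsub>regular_bimodule A\<^esub> y = x \<oplus>\<^bsub>A\<^esub> y"
  "a \<rightharpoonup>\<^bsub>regular_bimodule A\<^esub> x = a \<otimes>\<^bsub>A\<^esub> x"
  "x \<leftharpoonup>\<^bsub>regular_bimodule A\<^esub> a = x \<otimes>\<^bsub>A\<^esub> a"
  by (simp_all add: regular_bimodule_def)

lemma (in assoc_algebra) regular_bimodule: "bimodule K R R (regular_bimodule R)"
proof -
  have "abelian_group (regular_bimodule R)"
    by (rule abelian_groupI) (auto simp: M.a_ac intro: M.l_neg)
  then show ?thesis
    by (intro bimodule.intro bimodule_axioms.intro assoc_algebra_axioms)
      (simp_all add: l_distr r_distr m_assoc smult_mult_left smult_mult_right)
qed

text \<open>Right linearity of \<open>f\<close> and left linearity of \<open>g\<close> over the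
  middle ring \<open>R\<close> are what balancing asks for; the outer rings of source and target may
  differ.\<close>

lemma
  assumes "bimodule_pair K L R T M N" "bimodule_pair K' L' R T' M' N'"
    and "f \<in> add_hom M M'" "\<And>m r. \<lbrakk>m \<in> carrier M; r \<in> carrier R\<rbrakk> \<Longrightarrow> f (m \<leftharpoonup>\<^bsub>M\<^esub> r) = f m \<leftharpoonup>\<^bsub>M'\<^esub> r"
    and "g \<in> add_hom N N'" "\<And>r n. \<lbrakk>r \<in> carrier R; n \<in> carrier N\<rbrakk> \<Longrightarrow> g (r \<rightharpoonup>\<^bsub>N\<^esub> n) = r \<rightharpoonup>\<^bsub>N'\<^esub> g n"
  shows tensor_map_hom: "tensor_map R M' N' f g \<in> add_hom (tensor R M N) (tensor R M' N')"
    and tensor_map_elt: "\<And>m n. \<lbrakk>m \<in> carrier M; n \<in> carrier N\<rbrakk> \<Longrightarrow>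
      tensor_map R M' N' f g (tensor_elt R M N m n) = tensor_elt R M' N' (f m) (g n)"
proof -
  interpret A: bimodule_pair K L R T M N by fact
  interpret B: bimodule_pair K' L' R T' M' N' by fact
  have "balanced R M N B.X (\<lambda>m n. B.elt (f m) (g n))"
    using assms(3-6)
    by (intro balancedI)
      (simp_all add: add_hom_add add_hom_closed B.elt_closed B.elt_add_left B.elt_add_right B.elt_smult)
  note lift = A.tensor_lift_tensor_group[OF assms(2) this]
  show "tensor_map R M' N' f g \<in> add_hom (tensor R M N) (tensor R M' N')"
    unfolding tensor_map_def by (rule lift(1))
  show "tensor_map R M' N' f g (tensor_elt R M N m n) = tensor_elt R M' N' (f m) (g n)"
    if "m \<in> carrier M" "n \<in> carrier N" for m n
    unfolding tensor_map_def using that by (rule lift(2))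
qed

lemma
  assumes "bimodule K L R M" "bimodule K R S N" "bimodule K S T P"
  shows tensor_assoc_hom: "tensor_assoc R S M N P \<in>
      add_hom (tensor S (tensor R M N) P) (tensor R M (tensor S N P))"
    and tensor_assoc_elt: "\<And>m n p. \<lbrakk>m \<in> carrier M; n \<in> carrier N; p \<in> carrier P\<rbrakk> \<Longrightarrow>
      tensor_assoc R S M N P (tensor_elt S (tensor R M N) P (tensor_elt R M N m n) p) =
      tensor_elt R M (tensor S N P) m (tensor_elt S N P n p)"
proof -
  interpret MN: bimodule_pair K L R S M N using assms by (intro bimodule_pairI)
  interpret NP: bimodule_pair K R S T N P using assms by (intro bimodule_pairI)
  interpret MN_P: bimodule_pair K L S T "tensor R M N" P
    using assms by (intro bimodule_pairI bimodule_tensor)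
  interpret M_NP: bimodule_pair K L R T M "tensor S N P"
    using assms by (intro bimodule_pairI bimodule_tensor)
  \<comment> \<open>The associator is a lift of a lift. For fixed \<open>p\<close> the inner lift is
    known explicitly only on pure tensors of \<open>M\<close> and \<open>N\<close>, so additivity in
    \<open>p\<close> and balancing over \<open>S\<close> need an induction on
    \<open>t\<close>.\<close>
  define g where "g t p = tensor_lift (tensor_group R M (tensor S N P)) (\<lambda>m n. M_NP.elt m (NP.elt n p)) t" for t p
  have bal: "balanced R M N M_NP.X (\<lambda>m n. M_NP.elt m (NP.elt n p))" if "p \<in> carrier P" for p
    using that by (intro balancedI)
      (simp_all add: M_NP.elt_closed NP.elt_closed M_NP.elt_add_left NP.elt_add_left
        M_NP.elt_add_right M_NP.elt_smult NP.lsmult_elt)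
  note lift = MN.tensor_lift_tensor_group[OF M_NP.bimodule_pair_axioms bal, folded g_def]
  have hom: "(\<lambda>t. g t p) \<in> add_hom MN.X M_NP.X" if "p \<in> carrier P" for p
    unfolding g_def using MN.tensor_lift_tensor_group(1)[OF M_NP.bimodule_pair_axioms bal[OF that]] by simp
  have g_elt: "g (MN.elt m n) p = M_NP.elt m (NP.elt n p)"
    if "m \<in> carrier M" "n \<in> carrier N" "p \<in> carrier P" for m n p
    unfolding g_def using MN.tensor_lift_tensor_group(2)[OF M_NP.bimodule_pair_axioms bal] that by simp
  have bal': "balanced S MN.X P M_NP.X g"
  proof (rule balancedI)
    fix t p assume t: "t \<in> carrier MN.X" and p: "p \<in> carrier P"
    show "g t p \<in> carrier M_NP.X" using add_hom_closed[OF hom[OF p] t] .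
    show "g (t \<oplus>\<^bsub>MN.X\<^esub> s) p = g t p \<oplus>\<^bsub>M_NP.X\<^esub> g s p" if "s \<in> carrier MN.X" for s
      using add_hom_add[OF hom[OF p] t that] .
    show "g t (p \<oplus>\<^bsub>P\<^esub> q) = g t p \<oplus>\<^bsub>M_NP.X\<^esub> g t q" if q: "q \<in> carrier P" for q
      using t
    proof (induction rule: MN.tensor_induct)
      case (elt m n)
      then show ?case
        using p q
        by (simp add: g_elt NP.elt_add_right NP.elt_closed M_NP.elt_add_right)
    next
      case (add s t)
      then show ?case
        using p q by (simp add: add_hom_add[OF hom] add_hom_closed[OF hom] M_NP.X.a_ac)
    qed
    show "g (t \<leftharpoonup>\<^bsub>MN.X\<^esub> s) p = g t (s \<rightharpoonup>\<^bsub>P\<^esub> p)" if s: "s \<in> carrier S" for s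
      using t
    proof (induction rule: MN.tensor_induct)
      case (elt m n)
      then show ?case
        using p s by (simp add: MN.rsmult_elt g_elt
            MN.N.rsmult_closed NP.N.lsmult_closed NP.elt_smult)
    next
      case (add t t')
      then show ?case
        using p s by (simp add: add_hom_add[OF MN.rsmult_tensor_hom] add_hom_closed[OF MN.rsmult_tensor_hom]
            add_hom_add[OF hom] NP.N.lsmult_closed)
    qed
  qed
  note lift' = MN_P.tensor_lift_tensor_group[OF M_NP.bimodule_pair_axioms bal']
  have eq: "tensor_assoc R S M N P = tensor_lift (tensor_group R M (tensor S N P)) g"
    unfolding tensor_assoc_def g_def by simp
  show "tensor_assoc R S M N P \<in> add_hom (tensor S (tensor R M N) P) (tensor R M (tensor S N P))"
    unfolding eq by (rule lift'(1))
  show "tensor_assoc R S M N P (tensor_elt S (tensor R M N) P (tensor_elt R M N m n) p) =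
      tensor_elt R M (tensor S N P) m (tensor_elt S N P n p)"
    if "m \<in> carrier M" "n \<in> carrier N" "p \<in> carrier P" for m n p
    unfolding eq using that by (simp add: lift'(2) MN.elt_closed g_elt)
qed

section \<open>The unit identifications\<close>

context bimodule
begin

lemma pair_lunit: "bimodule_pair K L L R (regular_bimodule L) M"
  by (intro bimodule_pairI L.regular_bimodule bimodule_axioms)

lemma pair_runit: "bimodule_pair K L R R M (regular_bimodule R)"
  by (intro bimodule_pairI R.regular_bimodule bimodule_axioms)

lemma
  shows tensor_lunit_hom: "tensor_lunit M \<in> add_hom (tensor L (regular_bimodule L) M) M"
    and tensor_lunit_elt: "\<And>a m. \<lbrakk>a \<in> carrier L; m \<in> carrier M\<rbrakk> \<Longrightarrow>
      tensor_lunit M (tensor_elt L (regular_bimodule L) M a m) = a \<rightharpoonup> m"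
proof -
  interpret P: bimodule_pair K L L R "regular_bimodule L" M by (rule pair_lunit)
  have "balanced L (regular_bimodule L) M M (\<lambda>a m. a \<rightharpoonup> m)"
    by (intro balancedI) (simp_all add: lsmult_closed lsmult_l_distr lsmult_r_distr lsmult_assoc)
  note lift = P.tensor_lift_add_monoid[OF M.abelian_group_axioms this]
  show "tensor_lunit M \<in> add_hom (tensor L (regular_bimodule L) M) M"
    unfolding tensor_lunit_def by (rule lift(1))
  show "tensor_lunit M (tensor_elt L (regular_bimodule L) M a m) = a \<rightharpoonup> m"
    if "a \<in> carrier L" "m \<in> carrier M" for a m
    unfolding tensor_lunit_def using that by (simp add: lift(2))
qed

lemma
  shows tensor_runit_hom: "tensor_runit M \<in> add_hom (tensor R M (regular_bimodule R)) M"
    and tensor_runit_elt: "\<And>a m. \<lbrakk>m \<in> carrier M; a \<in> carrier R\<rbrakk> \<Longrightarrow>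
      tensor_runit M (tensor_elt R M (regular_bimodule R) m a) = m \<leftharpoonup> a"
proof -
  interpret P: bimodule_pair K L R R M "regular_bimodule R" by (rule pair_runit)
  have "balanced R M (regular_bimodule R) M (\<lambda>m a. m \<leftharpoonup> a)"
    by (intro balancedI) (simp_all add: rsmult_closed rsmult_l_distr rsmult_r_distr rsmult_assoc)
  note lift = P.tensor_lift_add_monoid[OF M.abelian_group_axioms this]
  show "tensor_runit M \<in> add_hom (tensor R M (regular_bimodule R)) M"
    unfolding tensor_runit_def by (rule lift(1))
  show "tensor_runit M (tensor_elt R M (regular_bimodule R) m a) = m \<leftharpoonup> a"
    if "m \<in> carrier M" "a \<in> carrier R" for a m
    unfolding tensor_runit_def using that by (simp add: lift(2))
qed

end

subsection \<open>Duals and endomorphisms of a bimodule\<close>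

text \<open>This rearrangement is what makes a pointwise sum of additive maps additive.\<close>

lemma (in abelian_group) add_interchange:
  "\<lbrakk>a \<in> carrier G; b \<in> carrier G; c \<in> carrier G; d \<in> carrier G\<rbrakk> \<Longrightarrow>
    (a \<oplus> b) \<oplus> (c \<oplus> d) = (a \<oplus> c) \<oplus> (b \<oplus> d)"
  by (simp add: a_ac)

context bimodule
begin

lemma lsmult_hom: "a \<in> carrier L \<Longrightarrow> (\<lambda>x. a \<rightharpoonup> x) \<in> add_hom M M"
  by (intro add_homI lsmult_closed lsmult_r_distr)

lemma rsmult_hom: "r \<in> carrier R \<Longrightarrow> (\<lambda>x. x \<leftharpoonup> r) \<in> add_hom M M"
  by (intro add_homI rsmult_closed rsmult_l_distr)

lemma lsmult_minus: "\<lbrakk>a \<in> carrier L; x \<in> carrier M\<rbrakk> \<Longrightarrow> a \<rightharpoonup> (\<ominus> x) = \<ominus> (a \<rightharpoonup> x)"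
  using group_hom.hom_inv[of "add_monoid M" "add_monoid M" "\<lambda>x. a \<rightharpoonup> x" x] lsmult_hom[of a] M.a_group
  by (simp add: group_hom_def group_hom_axioms_def a_inv_def)

lemma lsmult_zero: "a \<in> carrier L \<Longrightarrow> a \<rightharpoonup> \<zero> = \<zero>"
  using add_hom_zero[OF M.abelian_group_axioms M.abelian_group_axioms lsmult_hom] .

section \<open>The right dual as a bimodule\<close>

abbreviation "dual \<equiv> right_dual R M"

lemma right_dual_simps:
  "carrier dual = hom_right R M (regular_bimodule R)"
  "\<zero>\<^bsub>dual\<^esub> = (\<lambda>u\<in>carrier M. \<zero>\<^bsub>R\<^esub>)"
  "\<phi> \<oplus>\<^bsub>dual\<^esub> \<psi> = (\<lambda>u\<in>carrier M. \<phi> u \<oplus>\<^bsub>R\<^esub> \<psi> u)"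
  "a \<rightharpoonup>\<^bsub>dual\<^esub> \<phi> = (\<lambda>u\<in>carrier M. a \<otimes>\<^bsub>R\<^esub> \<phi> u)"
  "\<phi> \<leftharpoonup>\<^bsub>dual\<^esub> b = (\<lambda>u\<in>carrier M. \<phi> (b \<rightharpoonup> u))"
  by (simp_all add: right_dual_def)

lemma right_dual_apply:
  assumes "u \<in> carrier M"
  shows "\<zero>\<^bsub>dual\<^esub> u = \<zero>\<^bsub>R\<^esub>"
    "(\<phi> \<oplus>\<^bsub>dual\<^esub> \<psi>) u = \<phi> u \<oplus>\<^bsub>R\<^esub> \<psi> u"
    "(a \<rightharpoonup>\<^bsub>dual\<^esub> \<phi>) u = a \<otimes>\<^bsub>R\<^esub> \<phi> u"
    "(\<phi> \<leftharpoonup>\<^bsub>dual\<^esub> b) u = \<phi> (b \<rightharpoonup> u)"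
  using assms by (simp_all add: right_dual_simps(2-))

lemma right_dualI:
  assumes "\<phi> \<in> extensional (carrier M)" "\<And>u. u \<in> carrier M \<Longrightarrow> \<phi> u \<in> carrier R"
    and "\<And>u v. \<lbrakk>u \<in> carrier M; v \<in> carrier M\<rbrakk> \<Longrightarrow> \<phi> (u \<oplus> v) = \<phi> u \<oplus>\<^bsub>R\<^esub> \<phi> v"
    and "\<And>u a. \<lbrakk>u \<in> carrier M; a \<in> carrier R\<rbrakk> \<Longrightarrow> \<phi> (u \<leftharpoonup> a) = \<phi> u \<otimes>\<^bsub>R\<^esub> a"
  shows "\<phi> \<in> carrier dual"
  using assms by (simp add: right_dual_simps hom_right_def PiE_def Pi_def)

lemma
  assumes "\<phi> \<in> carrier dual"
  shows right_dual_closed: "u \<in> carrier M \<Longrightarrow> \<phi> u \<in> carrier R"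
    and right_dual_add: "\<lbrakk>u \<in> carrier M; v \<in> carrier M\<rbrakk> \<Longrightarrow> \<phi> (u \<oplus> v) = \<phi> u \<oplus>\<^bsub>R\<^esub> \<phi> v"
    and right_dual_smult: "\<lbrakk>u \<in> carrier M; a \<in> carrier R\<rbrakk> \<Longrightarrow> \<phi> (u \<leftharpoonup> a) = \<phi> u \<otimes>\<^bsub>R\<^esub> a"
    and right_dual_extensional: "\<phi> \<in> extensional (carrier M)"
  using assms by (auto simp: right_dual_simps hom_right_def PiE_def)

lemma right_dual_hom: "\<phi> \<in> carrier dual \<Longrightarrow> \<phi> \<in> add_hom M R"
  by (intro add_homI right_dual_closed right_dual_add)

lemma right_dual_eqI:
  assumes "\<phi> \<in> carrier dual" "\<psi> \<in> carrier dual" "\<And>u. u \<in> carrier M \<Longrightarrow> \<phi> u = \<psi> u"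
  shows "\<phi> = \<psi>"
  using assms by (intro extensionalityI[OF right_dual_extensional right_dual_extensional])

lemma right_dual_bimodule: "bimodule K R L dual"
proof -
  note cl = right_dual_closed right_dual_add right_dual_smult
  have add: "\<phi> \<oplus>\<^bsub>dual\<^esub> \<psi> \<in> carrier dual" if "\<phi> \<in> carrier dual" "\<psi> \<in> carrier dual" for \<phi> \<psi>
    using that by (intro right_dualI)
      (simp_all add: right_dual_simps(2-) cl rsmult_closed R.M.add_interchange R.l_distr)
  have ls: "a \<rightharpoonup>\<^bsub>dual\<^esub> \<phi> \<in> carrier dual" if "\<phi> \<in> carrier dual" "a \<in> carrier R" for \<phi> a
    using that by (intro right_dualI)
      (simp_all add: right_dual_simps(2-) cl rsmult_closed R.r_distr R.m_assoc)
  \<comment> \<open>Precomposing with the left action of \<open>b\<close> keeps a functional right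
    linear because the two actions on \<open>M\<close> commute.\<close>
  have rs: "\<phi> \<leftharpoonup>\<^bsub>dual\<^esub> b \<in> carrier dual" if "\<phi> \<in> carrier dual" "b \<in> carrier L" for \<phi> b
    using that by (intro right_dualI)
      (simp_all add: right_dual_simps(2-) cl rsmult_closed lsmult_closed lsmult_r_distr
        flip: lsmult_rsmult_assoc)
  have "abelian_group dual"
  proof (rule abelian_group_pointwise)
    show "abelian_group R" ..
    show "carrier dual \<subseteq> carrier M \<rightarrow>\<^sub>E carrier R"
      by (auto simp: right_dual_simps hom_right_def)
    show "\<zero>\<^bsub>dual\<^esub> \<in> carrier dual"
      by (rule right_dualI) (simp_all add: right_dual_simps(2-) rsmult_closed)
    show "(\<lambda>u\<in>carrier M. \<ominus>\<^bsub>R\<^esub> \<phi> u) \<in> carrier dual" if "\<phi> \<in> carrier dual" for \<phi>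
      using that by (intro right_dualI)
        (simp_all add: cl rsmult_closed R.M.minus_add R.l_minus)
  qed (simp_all add: right_dual_simps(2-) add[unfolded right_dual_simps(3)])
  moreover have "(k \<odot>\<^bsub>R\<^esub> \<one>\<^bsub>R\<^esub>) \<rightharpoonup>\<^bsub>dual\<^esub> \<phi> = \<phi> \<leftharpoonup>\<^bsub>dual\<^esub> (k \<odot>\<^bsub>L\<^esub> \<one>\<^bsub>L\<^esub>)"
    if k: "k \<in> carrier K" and \<phi>: "\<phi> \<in> carrier dual" for k \<phi>
  proof (rule right_dual_eqI)
    fix u assume u: "u \<in> carrier M"
    \<comment> \<open>Inside \<open>M\<close> the scalar moves to the right, where right linearity
      of \<open>\<phi>\<close> extracts it.\<close>
    then have "\<phi> ((k \<odot>\<^bsub>L\<^esub> \<one>\<^bsub>L\<^esub>) \<rightharpoonup> u) = k \<odot>\<^bsub>R\<^esub> \<phi> u"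
      using k \<phi> by (simp add: centralizes right_dual_smult R.smult_mult_right right_dual_closed)
    then show "((k \<odot>\<^bsub>R\<^esub> \<one>\<^bsub>R\<^esub>) \<rightharpoonup>\<^bsub>dual\<^esub> \<phi>) u = (\<phi> \<leftharpoonup>\<^bsub>dual\<^esub> (k \<odot>\<^bsub>L\<^esub> \<one>\<^bsub>L\<^esub>)) u"
      using u k \<phi> by (simp add: right_dual_simps(2-) R.smult_mult_left right_dual_closed)
  qed (use k \<phi> in \<open>simp_all add: ls rs\<close>)
  ultimately show ?thesis
    using add ls rs
    by (intro bimodule.intro bimodule_axioms.intro R.assoc_algebra_axioms L.assoc_algebra_axioms)
      (auto intro!: right_dual_eqI simp: right_dual_apply cl lsmult_closed R.l_distr R.r_distr
        R.m_assoc lsmult_l_distr lsmult_assoc lsmult_one)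
qed

section \<open>The algebra of left linear endomorphisms\<close>

abbreviation "endo \<equiv> end_left L M"

lemma end_left_simps:
  "carrier endo = hom_left L M M"
  "\<zero>\<^bsub>endo\<^esub> = (\<lambda>u\<in>carrier M. \<zero>)"
  "\<one>\<^bsub>endo\<^esub> = (\<lambda>u\<in>carrier M. u)"
  "f \<oplus>\<^bsub>endo\<^esub> g = (\<lambda>u\<in>carrier M. f u \<oplus> g u)"
  "f \<otimes>\<^bsub>endo\<^esub> g = compose (carrier M) g f"
  "k \<odot>\<^bsub>endo\<^esub> f = (\<lambda>u\<in>carrier M. (k \<odot>\<^bsub>L\<^esub> \<one>\<^bsub>L\<^esub>) \<rightharpoonup> f u)"
  by (simp_all add: end_left_def)

lemma end_left_apply:
  assumes "u \<in> carrier M"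
  shows "\<zero>\<^bsub>endo\<^esub> u = \<zero>" "\<one>\<^bsub>endo\<^esub> u = u"
    "(f \<oplus>\<^bsub>endo\<^esub> g) u = f u \<oplus> g u"
    "(f \<otimes>\<^bsub>endo\<^esub> g) u = g (f u)"
    "(k \<odot>\<^bsub>endo\<^esub> f) u = (k \<odot>\<^bsub>L\<^esub> \<one>\<^bsub>L\<^esub>) \<rightharpoonup> f u"
  using assms by (simp_all add: end_left_simps(2-) compose_def)

lemma end_leftI:
  assumes "f \<in> extensional (carrier M)" "\<And>u. u \<in> carrier M \<Longrightarrow> f u \<in> carrier M"
    and "\<And>u v. \<lbrakk>u \<in> carrier M; v \<in> carrier M\<rbrakk> \<Longrightarrow> f (u \<oplus> v) = f u \<oplus> f v"
    and "\<And>b u. \<lbrakk>b \<in> carrier L; u \<in> carrier M\<rbrakk> \<Longrightarrow> f (b \<rightharpoonup> u) = b \<rightharpoonup> f u"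
  shows "f \<in> carrier endo"
  using assms by (simp add: end_left_simps hom_left_def PiE_def Pi_def)

lemma
  assumes "f \<in> carrier endo"
  shows end_left_closed: "u \<in> carrier M \<Longrightarrow> f u \<in> carrier M"
    and end_left_add: "\<lbrakk>u \<in> carrier M; v \<in> carrier M\<rbrakk> \<Longrightarrow> f (u \<oplus> v) = f u \<oplus> f v"
    and end_left_smult: "\<lbrakk>b \<in> carrier L; u \<in> carrier M\<rbrakk> \<Longrightarrow> f (b \<rightharpoonup> u) = b \<rightharpoonup> f u"
    and end_left_extensional: "f \<in> extensional (carrier M)"
  using assms by (auto simp: end_left_simps hom_left_def PiE_def)

lemma end_left_eqI:
  assumes "f \<in> carrier endo" "g \<in> carrier endo" "\<And>u. u \<in> carrier M \<Longrightarrow> f u = g u"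
  shows "f = g"
  using assms by (intro extensionalityI[OF end_left_extensional end_left_extensional])

lemma end_left_assoc_algebra: "assoc_algebra K endo"
proof -
  note cl = end_left_closed end_left_add end_left_smult lsmult_closed
  have kL: "k \<odot>\<^bsub>L\<^esub> \<one>\<^bsub>L\<^esub> \<in> carrier L" if "k \<in> carrier K" for k
    using that by simp
  \<comment> \<open>Scalars of \<open>K\<close> act on \<open>M\<close> through multiples of the
    unit of \<open>L\<close>, which commute with every \<open>b\<close>. This is why a scalar
    multiple of a left linear map is left linear.\<close>
  have central: "(k \<odot>\<^bsub>L\<^esub> \<one>\<^bsub>L\<^esub>) \<rightharpoonup> (b \<rightharpoonup> u) = b \<rightharpoonup> ((k \<odot>\<^bsub>L\<^esub> \<one>\<^bsub>L\<^esub>) \<rightharpoonup> u)"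
    if "k \<in> carrier K" "b \<in> carrier L" "u \<in> carrier M" for k b u
    using that by (simp add: L.smult_mult_left L.smult_mult_right flip: lsmult_assoc)
  have add: "f \<oplus>\<^bsub>endo\<^esub> g \<in> carrier endo" if "f \<in> carrier endo" "g \<in> carrier endo" for f g
    using that by (intro end_leftI)
      (simp_all add: end_left_simps(2-) cl M.add_interchange lsmult_r_distr)
  have mult: "f \<otimes>\<^bsub>endo\<^esub> g \<in> carrier endo" if "f \<in> carrier endo" "g \<in> carrier endo" for f g
    using that by (intro end_leftI) (simp_all add: end_left_simps(2-) cl compose_def)
  have smult: "k \<odot>\<^bsub>endo\<^esub> f \<in> carrier endo" if "k \<in> carrier K" "f \<in> carrier endo" for k f
    using that by (intro end_leftI)
      (simp_all add: end_left_simps(2-) cl kL lsmult_r_distr central)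
  have one: "\<one>\<^bsub>endo\<^esub> \<in> carrier endo"
    by (intro end_leftI) (simp_all add: end_left_simps(2-) cl)
  have "abelian_group endo"
  proof (rule abelian_group_pointwise)
    show "abelian_group M" ..
    show "carrier endo \<subseteq> carrier M \<rightarrow>\<^sub>E carrier M"
      by (auto simp: end_left_simps hom_left_def)
    show "\<zero>\<^bsub>endo\<^esub> \<in> carrier endo"
      by (rule end_leftI) (simp_all add: end_left_simps(2-) lsmult_closed lsmult_zero)
    show "(\<lambda>u\<in>carrier M. \<ominus> f u) \<in> carrier endo" if "f \<in> carrier endo" for f
      using that by (intro end_leftI) (simp_all add: cl M.minus_add lsmult_minus)
  qed (simp_all add: end_left_simps(2-) add[unfolded end_left_simps(4)])
  moreover have "monoid endo"
    using mult one
    by (intro monoidI) (auto intro!: end_left_eqI simp: end_left_apply cl)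
  ultimately have "ring endo"
    using add mult
    by (intro ringI) (auto intro!: end_left_eqI simp: end_left_apply cl)
  have kadd: "((k \<oplus>\<^bsub>K\<^esub> l) \<odot>\<^bsub>L\<^esub> \<one>\<^bsub>L\<^esub>) \<rightharpoonup> u = (k \<odot>\<^bsub>L\<^esub> \<one>\<^bsub>L\<^esub>) \<rightharpoonup> u \<oplus> (l \<odot>\<^bsub>L\<^esub> \<one>\<^bsub>L\<^esub>) \<rightharpoonup> u"
    if "k \<in> carrier K" "l \<in> carrier K" "u \<in> carrier M" for k l u
    using that by (simp add: L.smult_l_distr lsmult_l_distr)
  have kmult: "((k \<otimes>\<^bsub>K\<^esub> l) \<odot>\<^bsub>L\<^esub> \<one>\<^bsub>L\<^esub>) \<rightharpoonup> u = (k \<odot>\<^bsub>L\<^esub> \<one>\<^bsub>L\<^esub>) \<rightharpoonup> ((l \<odot>\<^bsub>L\<^esub> \<one>\<^bsub>L\<^esub>) \<rightharpoonup> u)"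
    if "k \<in> carrier K" "l \<in> carrier K" "u \<in> carrier M" for k l u
    using that by (simp add: L.smult_assoc1 L.smult_mult_left flip: lsmult_assoc)
  have "module K endo"
    using add smult
    by (intro moduleI L.R.is_cring \<open>abelian_group endo\<close>)
      (auto intro!: end_left_eqI simp: end_left_apply cl kL kadd kmult lsmult_r_distr lsmult_one)
  then show ?thesis
    using \<open>ring endo\<close> mult smult
    by (intro assoc_algebra.intro assoc_algebra_axioms.intro)
      (auto intro!: end_left_eqI simp: end_left_apply cl kL)
qed

end

text \<open>Each equational axiom may be tested after applying the injective map \<open>h\<close>,
  where it becomes an axiom of \<open>S\<close>. Reversing products does no harm: associativity is
  read backwards, and the left and right versions of the distributive and scalar laws are
  exchanged.\<close>

lemma assoc_algebra_anti_transport: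
  fixes K :: "'k ring" and R (structure)
  assumes "assoc_algebra K S" and bij: "bij_betw h (carrier R) (carrier S)"
    and closed: "\<And>x y. \<lbrakk>x \<in> carrier R; y \<in> carrier R\<rbrakk> \<Longrightarrow> x \<oplus> y \<in> carrier R"
      "\<And>x y. \<lbrakk>x \<in> carrier R; y \<in> carrier R\<rbrakk> \<Longrightarrow> x \<otimes> y \<in> carrier R"
      "\<And>k x. \<lbrakk>k \<in> carrier K; x \<in> carrier R\<rbrakk> \<Longrightarrow> k \<odot> x \<in> carrier R"
      "\<zero> \<in> carrier R" "\<one> \<in> carrier R"
    and hom: "\<And>x y. \<lbrakk>x \<in> carrier R; y \<in> carrier R\<rbrakk> \<Longrightarrow> h (x \<oplus> y) = h x \<oplus>\<^bsub>S\<^esub> h y"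
      "\<And>x y. \<lbrakk>x \<in> carrier R; y \<in> carrier R\<rbrakk> \<Longrightarrow> h (x \<otimes> y) = h y \<otimes>\<^bsub>S\<^esub> h x"
      "\<And>k x. \<lbrakk>k \<in> carrier K; x \<in> carrier R\<rbrakk> \<Longrightarrow> h (k \<odot> x) = k \<odot>\<^bsub>S\<^esub> h x"
      "h \<zero> = \<zero>\<^bsub>S\<^esub>" "h \<one> = \<one>\<^bsub>S\<^esub>"
  shows assoc_algebra_anti_transport_algebra: "assoc_algebra K R"
    and assoc_algebra_anti_transport_iso: "h \<in> algebra_anti_iso K R S"
proof -
  interpret S: assoc_algebra K S by fact
  have hcl: "h x \<in> carrier S" if "x \<in> carrier R" for x
    using bij that by (auto simp: bij_betw_def)
  have eqI: "x = y" if "x \<in> carrier R" "y \<in> carrier R" "h x = h y" for x y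
    using bij that by (auto simp: bij_betw_def inj_on_def)
  have ag: "abelian_group R"
  proof (rule abelian_groupI)
    fix x assume x: "x \<in> carrier R"
    \<comment> \<open>Surjectivity of \<open>h\<close> supplies the additive inverse as a
      preimage.\<close>
    obtain y where y: "y \<in> carrier R" "h y = \<ominus>\<^bsub>S\<^esub> h x"
      using bij hcl[OF x] S.M.a_inv_closed unfolding bij_betw_def by (metis imageE)
    then show "\<exists>y\<in>carrier R. y \<oplus> x = \<zero>"
      using x by (intro bexI[of _ y] eqI) (simp_all add: closed hom hcl S.M.l_neg)
  qed (auto intro!: eqI simp: closed hom hcl S.M.a_ac)
  have "monoid R"
    by (intro monoidI) (auto intro!: eqI simp: closed hom hcl S.m_assoc)
  then have "ring R"
    by (intro ringI ag) (auto intro!: eqI simp: closed hom hcl S.r_distr S.l_distr)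
  have "module K R"
    by (intro moduleI ag S.R.is_cring)
      (auto intro!: eqI simp: closed hom hcl S.smult_l_distr S.smult_r_distr S.smult_assoc1)
  with \<open>ring R\<close> show "assoc_algebra K R"
    by (intro assoc_algebra.intro assoc_algebra_axioms.intro)
      (auto intro!: eqI simp: closed hom hcl S.smult_mult_left S.smult_mult_right)
  show "h \<in> algebra_anti_iso K R S"
    using bij by (auto simp: algebra_anti_iso_def ring_iso_def ring_hom_def hcl hom)
qed

subsection \<open>The comatrix coring\<close>

locale comatrix = bimodule K B A \<Sigma>
  for K :: "'k ring" and B :: "('k, 'b) module" and A :: "('k, 'a) module"
    and \<Sigma> :: "('b, 'a, 's) bimodule" +
  fixes I :: "'i set" and e' :: "'i \<Rightarrow> 's \<Rightarrow> 'a" and e :: "'i \<Rightarrow> 's"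
  assumes dual_basis: "dual_basis A \<Sigma> I e' e"
begin

abbreviation "\<Sigma>' \<equiv> right_dual A \<Sigma>"
abbreviation "C \<equiv> tensor B \<Sigma>' \<Sigma>"

text \<open>In the sequel \<open>P.elt \<phi> u\<close> is a pure tensor over \<open>B\<close>,
  hence an element of \<open>C\<close>, and \<open>Q.elt x y\<close> is a pure tensor over
  \<open>A\<close> of two elements of \<open>C\<close>. The target of the comultiplication is
  \<open>Q.X\<close>.\<close>

sublocale D: bimodule K A B \<Sigma>' by (rule right_dual_bimodule)
sublocale P: bimodule_pair K A B A \<Sigma>' \<Sigma> ..
sublocale C: bimodule K A A C by (rule P.tensor_bimodule)
sublocale Q: bimodule_pair K A A A C C ..

lemma finite_I: "finite I"
  and e'_closed: "i \<in> I \<Longrightarrow> e' i \<in> carrier \<Sigma>'"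
  and e_closed: "i \<in> I \<Longrightarrow> e i \<in> carrier \<Sigma>"
  and expand: "u \<in> carrier \<Sigma> \<Longrightarrow> (\<Oplus>\<^bsub>\<Sigma>\<^esub>i\<in>I. e i \<leftharpoonup>\<^bsub>\<Sigma>\<^esub> e' i u) = u"
  using dual_basis by (auto simp: dual_basis_def)

lemma e'_apply_closed: "\<lbrakk>i \<in> I; u \<in> carrier \<Sigma>\<rbrakk> \<Longrightarrow> e' i u \<in> carrier A"
  by (rule right_dual_closed[OF e'_closed])

lemma A_group: "abelian_group A" ..
lemma S_group: "abelian_group \<Sigma>" ..

lemmas closed = e'_closed e_closed e'_apply_closed lsmult_closed rsmult_closed
  D.lsmult_closed D.rsmult_closed P.elt_closed Q.elt_closed C.lsmult_closed C.rsmult_closed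

text \<open>The coefficients are left arbitrary because two choices occur: \<open>e' i u\<close>,
  which expands \<open>u\<close> itself, and \<open>f (P.elt (e' i) u)\<close>, which defines the
  endomorphism attached to \<open>f\<close>.\<close>

lemma dual_eval_sum:
  assumes "\<phi> \<in> carrier \<Sigma>'" "x \<in> I \<rightarrow> carrier \<Sigma>" "a \<in> I \<rightarrow> carrier A"
  shows "\<phi> (\<Oplus>\<^bsub>\<Sigma>\<^esub>i\<in>I. x i \<leftharpoonup>\<^bsub>\<Sigma>\<^esub> a i) = (\<Oplus>\<^bsub>A\<^esub>i\<in>I. \<phi> (x i) \<otimes>\<^bsub>A\<^esub> a i)"
proof -
  have "\<phi> (\<Oplus>\<^bsub>\<Sigma>\<^esub>i\<in>I. x i \<leftharpoonup>\<^bsub>\<Sigma>\<^esub> a i) = (\<Oplus>\<^bsub>A\<^esub>i\<in>I. \<phi> (x i \<leftharpoonup>\<^bsub>\<Sigma>\<^esub> a i))"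
    using assms finite_I
    by (intro add_hom_finsum S_group A_group right_dual_hom) (auto simp: Pi_iff closed)
  also have "\<dots> = (\<Oplus>\<^bsub>A\<^esub>i\<in>I. \<phi> (x i) \<otimes>\<^bsub>A\<^esub> a i)"
    using assms by (intro R.M.finsum_cong')
      (auto simp: right_dual_smult[OF assms(1)] right_dual_closed[OF assms(1)] Pi_iff)
  finally show ?thesis .
qed

lemma dual_eval_expand:
  assumes "\<phi> \<in> carrier \<Sigma>'" "u \<in> carrier \<Sigma>"
  shows "(\<Oplus>\<^bsub>A\<^esub>i\<in>I. \<phi> (e i) \<otimes>\<^bsub>A\<^esub> e' i u) = \<phi> u"
  using dual_eval_sum[of \<phi> e "\<lambda>i. e' i u"] assms expand[of u] by (simp add: Pi_iff closed)

lemma dual_expand: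
  assumes \<phi>: "\<phi> \<in> carrier \<Sigma>'"
  shows "(\<Oplus>\<^bsub>\<Sigma>'\<^esub>i\<in>I. \<phi> (e i) \<rightharpoonup>\<^bsub>\<Sigma>'\<^esub> e' i) = \<phi>"
proof (rule right_dual_eqI)
  have cl: "(\<lambda>i. \<phi> (e i) \<rightharpoonup>\<^bsub>\<Sigma>'\<^esub> e' i) \<in> I \<rightarrow> carrier \<Sigma>'"
    by (auto simp: right_dual_closed[OF \<phi>] closed)
  then show "(\<Oplus>\<^bsub>\<Sigma>'\<^esub>i\<in>I. \<phi> (e i) \<rightharpoonup>\<^bsub>\<Sigma>'\<^esub> e' i) \<in> carrier \<Sigma>'"
    by (rule D.M.finsum_closed)
  fix u assume u: "u \<in> carrier \<Sigma>"
  \<comment> \<open>Evaluation at \<open>u\<close> is additive on functionals, which moves it inside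
    the sum.\<close>
  have ev: "(\<lambda>\<psi>. \<psi> u) \<in> add_hom \<Sigma>' A"
    using u by (intro add_homI) (simp_all add: right_dual_closed right_dual_apply)
  have "(\<Oplus>\<^bsub>\<Sigma>'\<^esub>i\<in>I. \<phi> (e i) \<rightharpoonup>\<^bsub>\<Sigma>'\<^esub> e' i) u = (\<Oplus>\<^bsub>A\<^esub>i\<in>I. (\<phi> (e i) \<rightharpoonup>\<^bsub>\<Sigma>'\<^esub> e' i) u)"
    by (rule add_hom_finsum[OF D.M.abelian_group_axioms A_group ev finite_I cl])
  also have "\<dots> = \<phi> u"
    using u by (simp add: right_dual_apply dual_eval_expand[OF \<phi>])
  finally show "(\<Oplus>\<^bsub>\<Sigma>'\<^esub>i\<in>I. \<phi> (e i) \<rightharpoonup>\<^bsub>\<Sigma>'\<^esub> e' i) u = \<phi> u" .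
qed fact

text \<open>The coordinates \<open>e' i u\<close> determine \<open>u\<close>, so it is enough to
  test against the functionals of the dual basis.\<close>

lemma separation:
  assumes "u \<in> carrier \<Sigma>" "v \<in> carrier \<Sigma>" "\<And>\<phi>. \<phi> \<in> carrier \<Sigma>' \<Longrightarrow> \<phi> u = \<phi> v"
  shows "u = v"
proof -
  have "(\<Oplus>\<^bsub>\<Sigma>\<^esub>i\<in>I. e i \<leftharpoonup>\<^bsub>\<Sigma>\<^esub> e' i u) = (\<Oplus>\<^bsub>\<Sigma>\<^esub>i\<in>I. e i \<leftharpoonup>\<^bsub>\<Sigma>\<^esub> e' i v)"
    using assms(1,2) by (intro M.finsum_cong') (auto simp: closed assms(3)[OF e'_closed])
  then show ?thesis using expand assms by simp
qed

section \<open>Comultiplication and counit\<close>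

definition comult where
  "comult = tensor_lift (tensor_group A C C)
     (\<lambda>\<phi> u. \<Oplus>\<^bsub>Q.X\<^esub>i\<in>I. Q.elt (P.elt \<phi> (e i)) (P.elt (e' i) u))"

definition counit where
  "counit = tensor_lift (add_monoid A) (\<lambda>\<phi> u. \<phi> u)"

lemma comult_balanced_smult:
  assumes \<phi>: "\<phi> \<in> carrier \<Sigma>'" and b: "b \<in> carrier B" and u: "u \<in> carrier \<Sigma>"
  shows "(\<Oplus>\<^bsub>Q.X\<^esub>i\<in>I. Q.elt (P.elt (\<phi> \<leftharpoonup>\<^bsub>\<Sigma>'\<^esub> b) (e i)) (P.elt (e' i) u)) =
    (\<Oplus>\<^bsub>Q.X\<^esub>i\<in>I. Q.elt (P.elt \<phi> (e i)) (P.elt (e' i) (b \<rightharpoonup>\<^bsub>\<Sigma>\<^esub> u)))"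
proof -
  define a where "a j i = e' j (b \<rightharpoonup>\<^bsub>\<Sigma>\<^esub> e i)" for j i
  have a: "a j i \<in> carrier A" if "i \<in> I" "j \<in> I" for i j
    unfolding a_def using that b by (intro closed)
  \<comment> \<open>Here \<open>b\<close> passes to \<open>e i\<close>, and the result is expanded
    in the elements \<open>e j\<close>. The coefficients \<open>a j i\<close> then cross the tensor
    sign over \<open>A\<close> and land on \<open>e' i\<close>.\<close>
  have 1: "Q.elt (P.elt (\<phi> \<leftharpoonup>\<^bsub>\<Sigma>'\<^esub> b) (e i)) (P.elt (e' i) u) =
    (\<Oplus>\<^bsub>Q.X\<^esub>j\<in>I. Q.elt (P.elt \<phi> (e j)) (P.elt (a j i \<rightharpoonup>\<^bsub>\<Sigma>'\<^esub> e' i) u))" if i: "i \<in> I" for i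
  proof -
    let ?g = "\<lambda>x. Q.elt (P.elt \<phi> x) (P.elt (e' i) u)"
    have g: "?g \<in> add_hom \<Sigma> Q.X"
      using \<phi> u i by (intro add_hom_compose[OF P.elt_hom_right Q.elt_hom_left] closed)
    have "?g (b \<rightharpoonup>\<^bsub>\<Sigma>\<^esub> e i) = ?g (\<Oplus>\<^bsub>\<Sigma>\<^esub>j\<in>I. e j \<leftharpoonup>\<^bsub>\<Sigma>\<^esub> a j i)"
      unfolding a_def using b i by (simp add: expand closed)
    also have "\<dots> = (\<Oplus>\<^bsub>Q.X\<^esub>j\<in>I. ?g (e j \<leftharpoonup>\<^bsub>\<Sigma>\<^esub> a j i))"
      by (rule add_hom_finsum[OF S_group Q.tensor_abelian_group g finite_I])
        (use a i in \<open>auto simp: closed\<close>)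
    also have "\<dots> = (\<Oplus>\<^bsub>Q.X\<^esub>j\<in>I. Q.elt (P.elt \<phi> (e j)) (P.elt (a j i \<rightharpoonup>\<^bsub>\<Sigma>'\<^esub> e' i) u))"
      using a i \<phi> u
      by (intro Q.X.finsum_cong')
        (auto simp: closed Q.elt_smult P.lsmult_elt simp flip: P.rsmult_elt)
    finally show ?thesis
      using \<phi> b i by (simp add: P.elt_smult closed)
  qed
  \<comment> \<open>Now \<open>j\<close> is fixed, and \<open>a j i\<close> is the value at
    \<open>e i\<close> of the functional \<open>e' j\<close> acted on by \<open>b\<close>. So
    \<open>dual_expand\<close> reassembles that functional, and its \<open>b\<close> moves across to
    \<open>u\<close>.\<close>
  have 2: "(\<Oplus>\<^bsub>Q.X\<^esub>i\<in>I. Q.elt (P.elt \<phi> (e j)) (P.elt (a j i \<rightharpoonup>\<^bsub>\<Sigma>'\<^esub> e' i) u)) =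
    Q.elt (P.elt \<phi> (e j)) (P.elt (e' j) (b \<rightharpoonup>\<^bsub>\<Sigma>\<^esub> u))" if j: "j \<in> I" for j
  proof -
    let ?g = "\<lambda>\<psi>. Q.elt (P.elt \<phi> (e j)) (P.elt \<psi> u)"
    have g: "?g \<in> add_hom \<Sigma>' Q.X"
      using \<phi> u j by (intro add_hom_compose[OF P.elt_hom_left Q.elt_hom_right] closed)
    have "(\<Oplus>\<^bsub>Q.X\<^esub>i\<in>I. ?g (a j i \<rightharpoonup>\<^bsub>\<Sigma>'\<^esub> e' i)) = ?g (\<Oplus>\<^bsub>\<Sigma>'\<^esub>i\<in>I. a j i \<rightharpoonup>\<^bsub>\<Sigma>'\<^esub> e' i)"
      by (rule add_hom_finsum[OF D.M.abelian_group_axioms Q.tensor_abelian_group g finite_I, symmetric])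
        (use a j in \<open>auto simp: closed\<close>)
    also have "(\<Oplus>\<^bsub>\<Sigma>'\<^esub>i\<in>I. a j i \<rightharpoonup>\<^bsub>\<Sigma>'\<^esub> e' i) =
        (\<Oplus>\<^bsub>\<Sigma>'\<^esub>i\<in>I. (e' j \<leftharpoonup>\<^bsub>\<Sigma>'\<^esub> b) (e i) \<rightharpoonup>\<^bsub>\<Sigma>'\<^esub> e' i)"
      using b j by (intro D.M.finsum_cong') (auto simp: a_def right_dual_apply closed)
    also have "\<dots> = e' j \<leftharpoonup>\<^bsub>\<Sigma>'\<^esub> b"
      using b j by (intro dual_expand closed)
    finally show ?thesis
      using b j u by (simp add: P.elt_smult closed)
  qed
  have "(\<Oplus>\<^bsub>Q.X\<^esub>i\<in>I. Q.elt (P.elt (\<phi> \<leftharpoonup>\<^bsub>\<Sigma>'\<^esub> b) (e i)) (P.elt (e' i) u)) =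
    (\<Oplus>\<^bsub>Q.X\<^esub>i\<in>I. \<Oplus>\<^bsub>Q.X\<^esub>j\<in>I. Q.elt (P.elt \<phi> (e j)) (P.elt (a j i \<rightharpoonup>\<^bsub>\<Sigma>'\<^esub> e' i) u))"
    using 1 \<phi> u a by (intro Q.X.finsum_cong') (auto intro!: Q.X.finsum_closed closed)
  also have "\<dots> = (\<Oplus>\<^bsub>Q.X\<^esub>j\<in>I. \<Oplus>\<^bsub>Q.X\<^esub>i\<in>I. Q.elt (P.elt \<phi> (e j)) (P.elt (a j i \<rightharpoonup>\<^bsub>\<Sigma>'\<^esub> e' i) u))"
    using \<phi> u a by (intro Q.X.finsum_swap finite_I) (auto intro!: closed)
  also have "\<dots> = (\<Oplus>\<^bsub>Q.X\<^esub>j\<in>I. Q.elt (P.elt \<phi> (e j)) (P.elt (e' j) (b \<rightharpoonup>\<^bsub>\<Sigma>\<^esub> u)))"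
    using 2 \<phi> u b by (intro Q.X.finsum_cong') (auto intro!: closed)
  finally show ?thesis .
qed

lemma
  shows comult_hom: "comult \<in> add_hom C Q.X"
    and comult_elt: "\<And>\<phi> u. \<lbrakk>\<phi> \<in> carrier \<Sigma>'; u \<in> carrier \<Sigma>\<rbrakk> \<Longrightarrow>
      comult (P.elt \<phi> u) = (\<Oplus>\<^bsub>Q.X\<^esub>i\<in>I. Q.elt (P.elt \<phi> (e i)) (P.elt (e' i) u))"
proof -
  let ?h = "\<lambda>\<phi> u. \<Oplus>\<^bsub>Q.X\<^esub>i\<in>I. Q.elt (P.elt \<phi> (e i)) (P.elt (e' i) u)"
  have "balanced B \<Sigma>' \<Sigma> Q.X ?h"
    unfolding balanced_def
  proof (intro conjI ballI)
    show "(\<lambda>\<phi>. ?h \<phi> u) \<in> add_hom \<Sigma>' Q.X" if "u \<in> carrier \<Sigma>" for u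
      using that by (intro Q.X.finsum_add_hom finite_I add_hom_compose[OF P.elt_hom_left Q.elt_hom_left] closed)
    show "?h \<phi> \<in> add_hom \<Sigma> Q.X" if "\<phi> \<in> carrier \<Sigma>'" for \<phi>
      using that by (intro Q.X.finsum_add_hom finite_I add_hom_compose[OF P.elt_hom_right Q.elt_hom_right] closed)
  qed (rule comult_balanced_smult)
  note lift = P.tensor_lift_tensor_group[OF Q.bimodule_pair_axioms this]
  show "comult \<in> add_hom C Q.X"
    unfolding comult_def by (rule lift(1))
  show "comult (P.elt \<phi> u) = ?h \<phi> u" if "\<phi> \<in> carrier \<Sigma>'" "u \<in> carrier \<Sigma>" for \<phi> u
    unfolding comult_def using that by (rule lift(2))
qed

lemma
  shows counit_hom: "counit \<in> add_hom C A"
    and counit_elt: "\<And>\<phi> u. \<lbrakk>\<phi> \<in> carrier \<Sigma>'; u \<in> carrier \<Sigma>\<rbrakk> \<Longrightarrow> counit (P.elt \<phi> u) = \<phi> u"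
proof -
  \<comment> \<open>Balancing over \<open>B\<close> is the definition of the right action of
    \<open>B\<close> on functionals.\<close>
  have "balanced B \<Sigma>' \<Sigma> A (\<lambda>\<phi> u. \<phi> u)"
    by (intro balancedI right_dual_closed right_dual_add) (simp_all add: right_dual_apply)
  note lift = P.tensor_lift_add_monoid[OF A_group this]
  show "counit \<in> add_hom C A"
    unfolding counit_def by (rule lift(1))
  show "counit (P.elt \<phi> u) = \<phi> u" if "\<phi> \<in> carrier \<Sigma>'" "u \<in> carrier \<Sigma>" for \<phi> u
    unfolding counit_def using that by (rule lift(2))
qed

text \<open>Applying \<open>f\<close> before or after a scalar gives two additive maps, so linearity
  may be checked on pure tensors, where a left scalar reaches only \<open>\<phi>\<close> and a right
  scalar only \<open>u\<close>.\<close>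

lemma tensor_bimodule_homI:
  assumes "bimodule K A A N" and f: "f \<in> add_hom C N"
    and "\<And>a \<phi> u. \<lbrakk>a \<in> carrier A; \<phi> \<in> carrier \<Sigma>'; u \<in> carrier \<Sigma>\<rbrakk> \<Longrightarrow>
      f (P.elt (a \<rightharpoonup>\<^bsub>\<Sigma>'\<^esub> \<phi>) u) = a \<rightharpoonup>\<^bsub>N\<^esub> f (P.elt \<phi> u)"
    and "\<And>a \<phi> u. \<lbrakk>a \<in> carrier A; \<phi> \<in> carrier \<Sigma>'; u \<in> carrier \<Sigma>\<rbrakk> \<Longrightarrow>
      f (P.elt \<phi> (u \<leftharpoonup>\<^bsub>\<Sigma>\<^esub> a)) = f (P.elt \<phi> u) \<leftharpoonup>\<^bsub>N\<^esub> a"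
  shows "f \<in> bimodule_hom A A C N"
proof -
  interpret N: bimodule K A A N by fact
  have "f (a \<rightharpoonup>\<^bsub>C\<^esub> c) = a \<rightharpoonup>\<^bsub>N\<^esub> f c" if "a \<in> carrier A" "c \<in> carrier C" for a c
    by (rule P.tensor_hom_eqI[OF add_hom_compose[OF C.lsmult_hom f] add_hom_compose[OF f N.lsmult_hom]])
      (use assms(3) that in \<open>simp_all add: P.lsmult_elt\<close>)
  moreover have "f (c \<leftharpoonup>\<^bsub>C\<^esub> a) = f c \<leftharpoonup>\<^bsub>N\<^esub> a" if "a \<in> carrier A" "c \<in> carrier C" for a c
    by (rule P.tensor_hom_eqI[OF add_hom_compose[OF C.rsmult_hom f] add_hom_compose[OF f N.rsmult_hom]])
      (use assms(4) that in \<open>simp_all add: P.rsmult_elt\<close>)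
  ultimately show ?thesis
    using f by (auto simp: bimodule_hom_def add_hom_add add_hom_closed)
qed

text \<open>The dual basis elements are inserted between \<open>\<phi>\<close> and \<open>u\<close>,
  and the outer actions do not touch them.\<close>

lemma comult_bimodule_hom: "comult \<in> bimodule_hom A A C Q.X"
proof (rule tensor_bimodule_homI[OF Q.tensor_bimodule comult_hom])
  fix a \<phi> u assume a: "a \<in> carrier A" and \<phi>: "\<phi> \<in> carrier \<Sigma>'" and u: "u \<in> carrier \<Sigma>"
  have cl: "(\<lambda>i. Q.elt (P.elt \<phi> (e i)) (P.elt (e' i) u)) \<in> I \<rightarrow> carrier Q.X"
    using \<phi> u by (auto intro!: closed)
  have "a \<rightharpoonup>\<^bsub>Q.X\<^esub> comult (P.elt \<phi> u) =
      (\<Oplus>\<^bsub>Q.X\<^esub>i\<in>I. a \<rightharpoonup>\<^bsub>Q.X\<^esub> Q.elt (P.elt \<phi> (e i)) (P.elt (e' i) u))"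
    unfolding comult_elt[OF \<phi> u]
    by (rule add_hom_finsum[OF Q.tensor_abelian_group Q.tensor_abelian_group
          Q.lsmult_tensor_hom[OF a] finite_I cl])
  also have "\<dots> = comult (P.elt (a \<rightharpoonup>\<^bsub>\<Sigma>'\<^esub> \<phi>) u)"
    unfolding comult_elt[OF D.lsmult_closed[OF a \<phi>] u]
    using a \<phi> u by (intro Q.X.finsum_cong') (auto simp: closed Q.lsmult_elt P.lsmult_elt)
  finally show "comult (P.elt (a \<rightharpoonup>\<^bsub>\<Sigma>'\<^esub> \<phi>) u) = a \<rightharpoonup>\<^bsub>Q.X\<^esub> comult (P.elt \<phi> u)" by simp
  have "comult (P.elt \<phi> u) \<leftharpoonup>\<^bsub>Q.X\<^esub> a =
      (\<Oplus>\<^bsub>Q.X\<^esub>i\<in>I. Q.elt (P.elt \<phi> (e i)) (P.elt (e' i) u) \<leftharpoonup>\<^bsub>Q.X\<^esub> a)"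
    unfolding comult_elt[OF \<phi> u]
    by (rule add_hom_finsum[OF Q.tensor_abelian_group Q.tensor_abelian_group
          Q.rsmult_tensor_hom[OF a] finite_I cl])
  also have "\<dots> = comult (P.elt \<phi> (u \<leftharpoonup>\<^bsub>\<Sigma>\<^esub> a))"
    unfolding comult_elt[OF \<phi> rsmult_closed[OF u a]]
    using a \<phi> u by (intro Q.X.finsum_cong') (auto simp: closed Q.rsmult_elt P.rsmult_elt)
  finally show "comult (P.elt \<phi> (u \<leftharpoonup>\<^bsub>\<Sigma>\<^esub> a)) = comult (P.elt \<phi> u) \<leftharpoonup>\<^bsub>Q.X\<^esub> a" by simp
qed

lemma counit_bimodule_hom: "counit \<in> bimodule_hom A A C (regular_bimodule A)"
proof (rule tensor_bimodule_homI[OF R.regular_bimodule])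
  show "counit \<in> add_hom C (regular_bimodule A)"
    using counit_hom by (simp add: hom_def)
qed (simp_all add: counit_elt closed right_dual_apply right_dual_smult)

text \<open>Both sides are the double sum of \<open>\<phi> \<otimes> e i \<otimes> e' i \<otimes> e
  j \<otimes> e' j \<otimes> u\<close>. Splitting the second factor of \<open>comult c\<close> puts
  the sum over \<open>i\<close> outside, splitting the first puts the sum over \<open>j\<close>
  outside.\<close>

lemma coassociativity:
  assumes "c \<in> carrier C"
  shows "tensor_map A C Q.X id comult (comult c) =
    tensor_assoc A A C C C (tensor_map A Q.X C comult id (comult c))"
proof -
  interpret C_CC: bimodule_pair K A A A C Q.X
    by (intro bimodule_pairI C.bimodule_axioms Q.tensor_bimodule)
  interpret CC_C: bimodule_pair K A A A Q.X C
    by (intro bimodule_pairI C.bimodule_axioms Q.tensor_bimodule)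
  have id: "id \<in> add_hom C C" by (simp add: hom_def)
  have lin: "comult (a \<rightharpoonup>\<^bsub>C\<^esub> x) = a \<rightharpoonup>\<^bsub>Q.X\<^esub> comult x" "comult (x \<leftharpoonup>\<^bsub>C\<^esub> a) = comult x \<leftharpoonup>\<^bsub>Q.X\<^esub> a"
    if "a \<in> carrier A" "x \<in> carrier C" for a x
    using comult_bimodule_hom that by (auto simp: bimodule_hom_def)
  note left = tensor_map_hom[OF Q.bimodule_pair_axioms C_CC.bimodule_pair_axioms id _ comult_hom lin(1), simplified]
    tensor_map_elt[OF Q.bimodule_pair_axioms C_CC.bimodule_pair_axioms id _ comult_hom lin(1), simplified]
  note right = tensor_map_hom[OF Q.bimodule_pair_axioms CC_C.bimodule_pair_axioms comult_hom lin(2) id, simplified]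
    tensor_map_elt[OF Q.bimodule_pair_axioms CC_C.bimodule_pair_axioms comult_hom lin(2) id, simplified]
  note assoc = tensor_assoc_hom[OF C.bimodule_axioms C.bimodule_axioms C.bimodule_axioms]
    tensor_assoc_elt[OF C.bimodule_axioms C.bimodule_axioms C.bimodule_axioms]
  note groups = P.tensor_abelian_group Q.tensor_abelian_group C_CC.tensor_abelian_group CC_C.tensor_abelian_group
  let ?x = "\<lambda>i \<phi>. P.elt \<phi> (e i)" and ?y = "\<lambda>i u. P.elt (e' i) u"
  show ?thesis
  proof (rule P.tensor_hom_eqI[OF add_hom_compose[OF comult_hom left(1)]
        add_hom_compose[OF comult_hom add_hom_compose[OF right(1) assoc(1)]] _ assms])
    fix \<phi> u assume \<phi>: "\<phi> \<in> carrier \<Sigma>'" and u: "u \<in> carrier \<Sigma>"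
    let ?t = "\<lambda>i j. C_CC.elt (?x i \<phi>) (Q.elt (?x j (e' i)) (?y j u))"
    have t: "?t i j \<in> carrier C_CC.X" if "i \<in> I" "j \<in> I" for i j
      using that \<phi> u by (intro C_CC.elt_closed closed)
    have cl: "(\<lambda>i. Q.elt (?x i \<phi>) (?y i u)) \<in> I \<rightarrow> carrier Q.X"
      using \<phi> u by (auto intro!: closed)
    have "tensor_map A C Q.X id comult (comult (P.elt \<phi> u)) =
        (\<Oplus>\<^bsub>C_CC.X\<^esub>i\<in>I. tensor_map A C Q.X id comult (Q.elt (?x i \<phi>) (?y i u)))"
      unfolding comult_elt[OF \<phi> u] by (rule add_hom_finsum[OF groups(2,3) left(1) finite_I cl])
    also have "\<dots> = (\<Oplus>\<^bsub>C_CC.X\<^esub>i\<in>I. \<Oplus>\<^bsub>C_CC.X\<^esub>j\<in>I. ?t i j)"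
    proof (rule C_CC.X.finsum_cong'[OF refl])
      show "(\<lambda>i. \<Oplus>\<^bsub>C_CC.X\<^esub>j\<in>I. ?t i j) \<in> I \<rightarrow> carrier C_CC.X"
        using t by (auto intro!: C_CC.X.finsum_closed)
      fix i assume i: "i \<in> I"
      have "tensor_map A C Q.X id comult (Q.elt (?x i \<phi>) (?y i u)) =
          C_CC.elt (?x i \<phi>) (\<Oplus>\<^bsub>Q.X\<^esub>j\<in>I. Q.elt (?x j (e' i)) (?y j u))"
        using i \<phi> u by (simp add: left(2) closed comult_elt)
      also have "\<dots> = (\<Oplus>\<^bsub>C_CC.X\<^esub>j\<in>I. ?t i j)"
        using i \<phi> u
        by (intro add_hom_finsum[OF groups(2,3) C_CC.elt_hom_right finite_I]) (auto intro!: closed)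
      finally show "tensor_map A C Q.X id comult (Q.elt (?x i \<phi>) (?y i u)) = (\<Oplus>\<^bsub>C_CC.X\<^esub>j\<in>I. ?t i j)" .
    qed
    finally have lhs: "tensor_map A C Q.X id comult (comult (P.elt \<phi> u)) =
        (\<Oplus>\<^bsub>C_CC.X\<^esub>i\<in>I. \<Oplus>\<^bsub>C_CC.X\<^esub>j\<in>I. ?t i j)" .
    let ?T = "\<lambda>c. tensor_assoc A A C C C (tensor_map A Q.X C comult id c)"
    have T: "?T \<in> add_hom Q.X C_CC.X"
      by (rule add_hom_compose[OF right(1) assoc(1)])
    \<comment> \<open>The outer index is called \<open>j\<close> on this side, so that the terms
      become literally \<open>?t i j\<close> and only the order of summation differs.\<close>
    have "?T (comult (P.elt \<phi> u)) = (\<Oplus>\<^bsub>C_CC.X\<^esub>j\<in>I. ?T (Q.elt (?x j \<phi>) (?y j u)))"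
      unfolding comult_elt[OF \<phi> u] by (rule add_hom_finsum[OF groups(2,3) T finite_I cl])
    also have "\<dots> = (\<Oplus>\<^bsub>C_CC.X\<^esub>j\<in>I. \<Oplus>\<^bsub>C_CC.X\<^esub>i\<in>I. ?t i j)"
    proof (rule C_CC.X.finsum_cong'[OF refl])
      show "(\<lambda>j. \<Oplus>\<^bsub>C_CC.X\<^esub>i\<in>I. ?t i j) \<in> I \<rightarrow> carrier C_CC.X"
        using t by (auto intro!: C_CC.X.finsum_closed)
      fix j assume j: "j \<in> I"
      \<comment> \<open>Adjoining a fixed right factor and reassociating is a single additive map,
        so the inner sum passes through both at once.\<close>
      let ?g = "\<lambda>z. tensor_assoc A A C C C (CC_C.elt z (?y j u))"
      have g: "?g \<in> add_hom Q.X C_CC.X"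
        using j u by (intro add_hom_compose[OF CC_C.elt_hom_left assoc(1)] closed)
      have "?T (Q.elt (?x j \<phi>) (?y j u)) =
          ?g (\<Oplus>\<^bsub>Q.X\<^esub>i\<in>I. Q.elt (?x i \<phi>) (?y i (e j)))"
        using j \<phi> u by (simp add: right(2) closed comult_elt)
      also have "\<dots> = (\<Oplus>\<^bsub>C_CC.X\<^esub>i\<in>I. ?g (Q.elt (?x i \<phi>) (?y i (e j))))"
        using j \<phi> by (intro add_hom_finsum[OF groups(2,3) g finite_I]) (auto intro!: closed)
      also have "\<dots> = (\<Oplus>\<^bsub>C_CC.X\<^esub>i\<in>I. ?t i j)"
        using t j \<phi> u by (intro C_CC.X.finsum_cong') (auto simp: assoc(2) closed)
      finally show "?T (Q.elt (?x j \<phi>) (?y j u)) = (\<Oplus>\<^bsub>C_CC.X\<^esub>i\<in>I. ?t i j)" .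
    qed
    also have "\<dots> = (\<Oplus>\<^bsub>C_CC.X\<^esub>i\<in>I. \<Oplus>\<^bsub>C_CC.X\<^esub>j\<in>I. ?t i j)"
      using t by (intro C_CC.X.finsum_swap finite_I)
    finally show "tensor_map A C Q.X id comult (comult (P.elt \<phi> u)) = ?T (comult (P.elt \<phi> u))"
      using lhs by simp
  qed
qed

text \<open>The operator \<open>c \<mapsto> c\<^sub>1 g(c\<^sub>2)\<close>, through which the convolution product and the right counit law factor.\<close>

abbreviation "act g c \<equiv> tensor_runit C (tensor_map A C (regular_bimodule A) id g (comult c))"

text \<open>Left linearity of \<open>g\<close> makes the tensor map of \<open>id\<close> and
  \<open>g\<close> well defined over \<open>A\<close>. On a pure tensor the operator keeps
  \<open>\<phi>\<close> and replaces \<open>u\<close> by the vector that later becomes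
  \<open>to_endo g u\<close>.\<close>

lemma
  assumes g: "g \<in> add_hom C A" "\<And>a c. \<lbrakk>a \<in> carrier A; c \<in> carrier C\<rbrakk> \<Longrightarrow> g (a \<rightharpoonup>\<^bsub>C\<^esub> c) = a \<otimes>\<^bsub>A\<^esub> g c"
  shows act_hom: "act g \<in> add_hom C C"
    and act_elt: "\<And>\<phi> u. \<lbrakk>\<phi> \<in> carrier \<Sigma>'; u \<in> carrier \<Sigma>\<rbrakk> \<Longrightarrow>
      act g (P.elt \<phi> u) = P.elt \<phi> (\<Oplus>\<^bsub>\<Sigma>\<^esub>i\<in>I. e i \<leftharpoonup>\<^bsub>\<Sigma>\<^esub> g (P.elt (e' i) u))"
proof -
  have id: "id \<in> add_hom C C" by (simp add: hom_def)
  have g': "g \<in> add_hom C (regular_bimodule A)" using g(1) by (simp add: hom_def)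
  note map = tensor_map_hom[OF Q.bimodule_pair_axioms C.pair_runit id _ g', simplified, OF g(2)]
    tensor_map_elt[OF Q.bimodule_pair_axioms C.pair_runit id _ g', simplified, OF g(2)]
  let ?T = "\<lambda>x. tensor_runit C (tensor_map A C (regular_bimodule A) id g x)"
  have T: "?T \<in> add_hom Q.X C" by (rule add_hom_compose[OF map(1) C.tensor_runit_hom])
  show "act g \<in> add_hom C C" by (rule add_hom_compose[OF comult_hom T])
  fix \<phi> u assume \<phi>: "\<phi> \<in> carrier \<Sigma>'" and u: "u \<in> carrier \<Sigma>"
  have gcl: "g (P.elt (e' i) u) \<in> carrier A" if "i \<in> I" for i
    using that u by (intro add_hom_closed[OF g(1)] closed)
  have "act g (P.elt \<phi> u) = (\<Oplus>\<^bsub>C\<^esub>i\<in>I. ?T (Q.elt (P.elt \<phi> (e i)) (P.elt (e' i) u)))"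
    unfolding comult_elt[OF \<phi> u]
    using \<phi> u by (intro add_hom_finsum[OF Q.tensor_abelian_group P.tensor_abelian_group T finite_I])
      (auto intro!: closed)
  also have "\<dots> = (\<Oplus>\<^bsub>C\<^esub>i\<in>I. P.elt \<phi> (e i \<leftharpoonup>\<^bsub>\<Sigma>\<^esub> g (P.elt (e' i) u)))"
    using \<phi> u gcl by (intro P.X.finsum_cong') (auto simp: map(2) C.tensor_runit_elt P.rsmult_elt closed)
  also have "\<dots> = P.elt \<phi> (\<Oplus>\<^bsub>\<Sigma>\<^esub>i\<in>I. e i \<leftharpoonup>\<^bsub>\<Sigma>\<^esub> g (P.elt (e' i) u))"
    using gcl by (intro add_hom_finsum[OF S_group P.tensor_abelian_group P.elt_hom_right[OF \<phi>] finite_I, symmetric])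
      (auto simp: closed)
  finally show "act g (P.elt \<phi> u) = P.elt \<phi> (\<Oplus>\<^bsub>\<Sigma>\<^esub>i\<in>I. e i \<leftharpoonup>\<^bsub>\<Sigma>\<^esub> g (P.elt (e' i) u))" .
qed

lemma counit_lsmult: "\<lbrakk>a \<in> carrier A; c \<in> carrier C\<rbrakk> \<Longrightarrow> counit (a \<rightharpoonup>\<^bsub>C\<^esub> c) = a \<otimes>\<^bsub>A\<^esub> counit c"
  and counit_rsmult: "\<lbrakk>a \<in> carrier A; c \<in> carrier C\<rbrakk> \<Longrightarrow> counit (c \<leftharpoonup>\<^bsub>C\<^esub> a) = counit c \<otimes>\<^bsub>A\<^esub> a"
  using counit_bimodule_hom by (auto simp: bimodule_hom_def)

text \<open>For \<open>g = counit\<close> the new second factor is the dual basis expansion of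
  \<open>u\<close>.\<close>

lemma right_counit:
  assumes "c \<in> carrier C"
  shows "act counit c = c"
proof (rule P.tensor_hom_eqI[OF act_hom[OF counit_hom counit_lsmult] _ _ assms])
  show "(\<lambda>c. c) \<in> add_hom C C" by (simp add: hom_def)
  show "act counit (P.elt \<phi> u) = P.elt \<phi> u" if "\<phi> \<in> carrier \<Sigma>'" "u \<in> carrier \<Sigma>" for \<phi> u
  proof -
    have "(\<Oplus>\<^bsub>\<Sigma>\<^esub>i\<in>I. e i \<leftharpoonup>\<^bsub>\<Sigma>\<^esub> counit (P.elt (e' i) u)) = (\<Oplus>\<^bsub>\<Sigma>\<^esub>i\<in>I. e i \<leftharpoonup>\<^bsub>\<Sigma>\<^esub> e' i u)"
      using that by (intro M.finsum_cong') (auto simp: counit_elt closed)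
    then show ?thesis
      using that by (simp add: act_elt[OF counit_hom counit_lsmult] expand)
  qed
qed

text \<open>The scalar \<open>\<phi> (e i)\<close> produced by the counit acts on
  \<open>e' i\<close>, and the sum is the expansion of the functional \<open>\<phi>\<close>.\<close>

lemma left_counit:
  assumes "c \<in> carrier C"
  shows "tensor_lunit C (tensor_map A (regular_bimodule A) C counit id (comult c)) = c"
proof -
  have id: "id \<in> add_hom C C" by (simp add: hom_def)
  have counit': "counit \<in> add_hom C (regular_bimodule A)" using counit_hom by (simp add: hom_def)
  note map = tensor_map_hom[OF Q.bimodule_pair_axioms C.pair_lunit counit' _ id, simplified, OF counit_rsmult]
    tensor_map_elt[OF Q.bimodule_pair_axioms C.pair_lunit counit' _ id, simplified, OF counit_rsmult]
  let ?T = "\<lambda>x. tensor_lunit C (tensor_map A (regular_bimodule A) C counit id x)"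
  have T: "?T \<in> add_hom Q.X C" by (rule add_hom_compose[OF map(1) C.tensor_lunit_hom])
  show ?thesis
  proof (rule P.tensor_hom_eqI[OF add_hom_compose[OF comult_hom T] _ _ assms])
    show "(\<lambda>c. c) \<in> add_hom C C" by (simp add: hom_def)
    fix \<phi> u assume \<phi>: "\<phi> \<in> carrier \<Sigma>'" and u: "u \<in> carrier \<Sigma>"
    note \<phi>cl = right_dual_closed[OF \<phi>]
    have "?T (comult (P.elt \<phi> u)) = (\<Oplus>\<^bsub>C\<^esub>i\<in>I. ?T (Q.elt (P.elt \<phi> (e i)) (P.elt (e' i) u)))"
      unfolding comult_elt[OF \<phi> u]
      using \<phi> u by (intro add_hom_finsum[OF Q.tensor_abelian_group P.tensor_abelian_group T finite_I])
        (auto intro!: closed)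
    also have "\<dots> = (\<Oplus>\<^bsub>C\<^esub>i\<in>I. P.elt (\<phi> (e i) \<rightharpoonup>\<^bsub>\<Sigma>'\<^esub> e' i) u)"
      using \<phi> u by (intro P.X.finsum_cong')
        (auto simp: map(2) C.tensor_lunit_elt P.lsmult_elt closed counit_elt \<phi>cl)
    also have "\<dots> = P.elt (\<Oplus>\<^bsub>\<Sigma>'\<^esub>i\<in>I. \<phi> (e i) \<rightharpoonup>\<^bsub>\<Sigma>'\<^esub> e' i) u"
      by (intro add_hom_finsum[OF D.M.abelian_group_axioms P.tensor_abelian_group P.elt_hom_left[OF u] finite_I, symmetric])
        (auto simp: closed \<phi>cl)
    finally show "?T (comult (P.elt \<phi> u)) = P.elt \<phi> u"
      by (simp add: dual_expand[OF \<phi>])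
  qed
qed

lemma coring: "coring K A C comult counit"
  by (intro coring.intro coring_axioms.intro C.bimodule_axioms comult_bimodule_hom counit_bimodule_hom
      coassociativity left_counit right_counit)

end

subsection \<open>The left dual of the comatrix coring\<close>

context comatrix
begin

abbreviation "\<D> \<equiv> left_dual A C comult counit"

lemma left_dual_simps:
  "carrier \<D> = hom_left A C (regular_bimodule A)"
  "\<zero>\<^bsub>\<D>\<^esub> = (\<lambda>c\<in>carrier C. \<zero>\<^bsub>A\<^esub>)"
  "\<one>\<^bsub>\<D>\<^esub> = restrict counit (carrier C)"
  "f \<oplus>\<^bsub>\<D>\<^esub> g = (\<lambda>c\<in>carrier C. f c \<oplus>\<^bsub>A\<^esub> g c)"
  "f \<otimes>\<^bsub>\<D>\<^esub> g = (\<lambda>c\<in>carrier C. f (act g c))"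
  "k \<odot>\<^bsub>\<D>\<^esub> f = (\<lambda>c\<in>carrier C. k \<odot>\<^bsub>A\<^esub> f c)"
  by (simp_all add: left_dual_def)

text \<open>Both sides of left linearity are additive in \<open>c\<close>, so pure tensors suffice.
  The restriction provides the extensional representative that the carrier demands.\<close>

lemma left_dualI:
  assumes "f \<in> add_hom C A"
    and "\<And>a \<phi> u. \<lbrakk>a \<in> carrier A; \<phi> \<in> carrier \<Sigma>'; u \<in> carrier \<Sigma>\<rbrakk> \<Longrightarrow>
      f (P.elt (a \<rightharpoonup>\<^bsub>\<Sigma>'\<^esub> \<phi>) u) = a \<otimes>\<^bsub>A\<^esub> f (P.elt \<phi> u)"
  shows "restrict f (carrier C) \<in> carrier \<D>"
proof -
  have "f (a \<rightharpoonup>\<^bsub>C\<^esub> c) = a \<otimes>\<^bsub>A\<^esub> f c" if a: "a \<in> carrier A" and c: "c \<in> carrier C" for a c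
  proof (rule P.tensor_hom_eqI[OF add_hom_compose[OF C.lsmult_hom[OF a] assms(1)] _ _ c])
    show "(\<lambda>c. a \<otimes>\<^bsub>A\<^esub> f c) \<in> add_hom C A"
      using a by (intro add_homI)
        (simp_all add: add_hom_add[OF assms(1)] add_hom_closed[OF assms(1)] R.r_distr)
  qed (use assms(2) a in \<open>simp add: P.lsmult_elt\<close>)
  then show ?thesis
    using assms(1)
    by (auto simp: left_dual_simps hom_left_def add_hom_add add_hom_closed C.lsmult_closed)
qed

lemma
  assumes "f \<in> carrier \<D>"
  shows left_dual_hom: "f \<in> add_hom C A"
    and left_dual_smult: "\<And>a c. \<lbrakk>a \<in> carrier A; c \<in> carrier C\<rbrakk> \<Longrightarrow> f (a \<rightharpoonup>\<^bsub>C\<^esub> c) = a \<otimes>\<^bsub>A\<^esub> f c"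
    and left_dual_extensional: "f \<in> extensional (carrier C)"
  using assms by (simp_all add: left_dual_simps hom_left_def PiE_def hom_def)

lemma left_dual_elt_closed:
  "\<lbrakk>f \<in> carrier \<D>; \<phi> \<in> carrier \<Sigma>'; u \<in> carrier \<Sigma>\<rbrakk> \<Longrightarrow> f (P.elt \<phi> u) \<in> carrier A"
  by (intro add_hom_closed[OF left_dual_hom] closed)

lemma left_dual_eqI:
  assumes f: "f \<in> carrier \<D>" and g: "g \<in> carrier \<D>"
    and "\<And>\<phi> u. \<lbrakk>\<phi> \<in> carrier \<Sigma>'; u \<in> carrier \<Sigma>\<rbrakk> \<Longrightarrow> f (P.elt \<phi> u) = g (P.elt \<phi> u)"
  shows "f = g"
  by (rule extensionalityI[OF left_dual_extensional[OF f] left_dual_extensional[OF g]],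
      rule P.tensor_hom_eqI[OF left_dual_hom[OF f] left_dual_hom[OF g]]) (rule assms(3))

text \<open>The formula is forced: if \<open>\<phi> (F u) = f (P.elt \<phi> u)\<close> is to hold
  for every \<open>\<phi>\<close>, then the choice \<open>\<phi> = e' i\<close> prescribes the
  coordinates of \<open>F u\<close>.\<close>

definition to_endo where
  "to_endo f = (\<lambda>u\<in>carrier \<Sigma>. \<Oplus>\<^bsub>\<Sigma>\<^esub>i\<in>I. e i \<leftharpoonup>\<^bsub>\<Sigma>\<^esub> f (P.elt (e' i) u))"

lemma to_endo_closed:
  assumes "f \<in> carrier \<D>" "u \<in> carrier \<Sigma>"
  shows "to_endo f u \<in> carrier \<Sigma>"
  using assms by (auto simp: to_endo_def closed left_dual_elt_closed intro!: M.finsum_closed)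

text \<open>Left linearity draws the coefficients \<open>\<phi> (e i)\<close> into the argument of
  \<open>f\<close>, where they combine with the \<open>e' i\<close> to give back
  \<open>\<phi>\<close>.\<close>

lemma dual_to_endo:
  assumes f: "f \<in> carrier \<D>" and \<phi>: "\<phi> \<in> carrier \<Sigma>'" and u: "u \<in> carrier \<Sigma>"
  shows "\<phi> (to_endo f u) = f (P.elt \<phi> u)"
proof -
  note \<phi>cl = right_dual_closed[OF \<phi>]
  have fcl: "f (P.elt (e' i) u) \<in> carrier A" if "i \<in> I" for i
    using that u by (intro left_dual_elt_closed f closed)
  have g: "(\<lambda>\<psi>. f (P.elt \<psi> u)) \<in> add_hom \<Sigma>' A"
    by (rule add_hom_compose[OF P.elt_hom_left[OF u] left_dual_hom[OF f]])
  have "\<phi> (to_endo f u) = (\<Oplus>\<^bsub>A\<^esub>i\<in>I. \<phi> (e i) \<otimes>\<^bsub>A\<^esub> f (P.elt (e' i) u))"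
    using u fcl by (simp add: to_endo_def dual_eval_sum[OF \<phi>] Pi_iff closed)
  also have "\<dots> = (\<Oplus>\<^bsub>A\<^esub>i\<in>I. f (P.elt (\<phi> (e i) \<rightharpoonup>\<^bsub>\<Sigma>'\<^esub> e' i) u))"
    using u fcl by (intro R.M.finsum_cong')
      (auto simp: \<phi>cl closed left_dual_smult[OF f] simp flip: P.lsmult_elt)
  also have "\<dots> = f (P.elt (\<Oplus>\<^bsub>\<Sigma>'\<^esub>i\<in>I. \<phi> (e i) \<rightharpoonup>\<^bsub>\<Sigma>'\<^esub> e' i) u)"
    by (intro add_hom_finsum[OF D.M.abelian_group_axioms A_group g finite_I, symmetric])
      (auto simp: closed \<phi>cl)
  finally show ?thesis by (simp add: dual_expand[OF \<phi>])
qed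

text \<open>Replaces the explicit sum by its characterization: a proposed value of the endomorphism
  is verified by testing it against functionals.\<close>

lemma to_endo_eqI:
  assumes "f \<in> carrier \<D>" "u \<in> carrier \<Sigma>" "v \<in> carrier \<Sigma>"
    and "\<And>\<phi>. \<phi> \<in> carrier \<Sigma>' \<Longrightarrow> f (P.elt \<phi> u) = \<phi> v"
  shows "to_endo f u = v"
  using assms by (intro separation to_endo_closed) (simp_all add: dual_to_endo)

text \<open>Linearity over \<open>B\<close> comes from balancing: moving \<open>b\<close> from
  \<open>u\<close> to \<open>\<phi>\<close> inside \<open>f\<close> turns
  \<open>f (P.elt \<phi> (b \<rightharpoonup> u))\<close> into the value of
  \<open>\<phi> \<leftharpoonup> b\<close> at \<open>to_endo f u\<close>.\<close>

lemma to_endo_in_endo: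
  assumes f: "f \<in> carrier \<D>"
  shows "to_endo f \<in> carrier endo"
proof (rule end_leftI)
  note cl = to_endo_closed[OF f]
  fix u assume u: "u \<in> carrier \<Sigma>"
  show "to_endo f (u \<oplus>\<^bsub>\<Sigma>\<^esub> v) = to_endo f u \<oplus>\<^bsub>\<Sigma>\<^esub> to_endo f v" if "v \<in> carrier \<Sigma>" for v
    using that u by (intro to_endo_eqI[OF f])
      (simp_all add: cl right_dual_add dual_to_endo[OF f] P.elt_add_right add_hom_add[OF left_dual_hom[OF f]] closed)
  show "to_endo f (b \<rightharpoonup>\<^bsub>\<Sigma>\<^esub> u) = b \<rightharpoonup>\<^bsub>\<Sigma>\<^esub> to_endo f u" if b: "b \<in> carrier B" for b
  proof (rule to_endo_eqI[OF f])
    fix \<phi> assume \<phi>: "\<phi> \<in> carrier \<Sigma>'"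
    have "f (P.elt \<phi> (b \<rightharpoonup>\<^bsub>\<Sigma>\<^esub> u)) = (\<phi> \<leftharpoonup>\<^bsub>\<Sigma>'\<^esub> b) (to_endo f u)"
      using b u \<phi> by (simp add: dual_to_endo[OF f] closed P.elt_smult)
    then show "f (P.elt \<phi> (b \<rightharpoonup>\<^bsub>\<Sigma>\<^esub> u)) = \<phi> (b \<rightharpoonup>\<^bsub>\<Sigma>\<^esub> to_endo f u)"
      using u by (simp add: right_dual_apply cl)
  qed (use b u cl in \<open>simp_all add: closed\<close>)
qed (use to_endo_closed[OF f] in \<open>auto simp: to_endo_def\<close>)

text \<open>The product formula is where the comultiplication disappears from the argument:
  convolving with \<open>g\<close> on the right means applying \<open>to_endo g\<close> to the
  second tensor factor.\<close>

lemma left_dual_ops_apply: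
  assumes "f \<in> carrier \<D>" "g \<in> carrier \<D>" "\<phi> \<in> carrier \<Sigma>'" "u \<in> carrier \<Sigma>"
  shows "(f \<oplus>\<^bsub>\<D>\<^esub> g) (P.elt \<phi> u) = f (P.elt \<phi> u) \<oplus>\<^bsub>A\<^esub> g (P.elt \<phi> u)"
    and "(f \<otimes>\<^bsub>\<D>\<^esub> g) (P.elt \<phi> u) = f (P.elt \<phi> (to_endo g u))"
    and "(k \<odot>\<^bsub>\<D>\<^esub> f) (P.elt \<phi> u) = k \<odot>\<^bsub>A\<^esub> f (P.elt \<phi> u)"
  using assms
  by (simp_all add: left_dual_simps(2-) closed to_endo_def act_elt[OF left_dual_hom left_dual_smult])

lemma left_dual_zero_apply: "\<lbrakk>\<phi> \<in> carrier \<Sigma>'; u \<in> carrier \<Sigma>\<rbrakk> \<Longrightarrow> \<zero>\<^bsub>\<D>\<^esub> (P.elt \<phi> u) = \<zero>\<^bsub>A\<^esub>"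
  and left_dual_one_apply: "\<lbrakk>\<phi> \<in> carrier \<Sigma>'; u \<in> carrier \<Sigma>\<rbrakk> \<Longrightarrow> \<one>\<^bsub>\<D>\<^esub> (P.elt \<phi> u) = \<phi> u"
  by (simp_all add: left_dual_simps(2-) closed counit_elt)

lemma left_dual_ops_closed:
  shows "\<lbrakk>f \<in> carrier \<D>; g \<in> carrier \<D>\<rbrakk> \<Longrightarrow> f \<oplus>\<^bsub>\<D>\<^esub> g \<in> carrier \<D>"
    and "\<lbrakk>f \<in> carrier \<D>; g \<in> carrier \<D>\<rbrakk> \<Longrightarrow> f \<otimes>\<^bsub>\<D>\<^esub> g \<in> carrier \<D>"
    and "\<lbrakk>k \<in> carrier K; f \<in> carrier \<D>\<rbrakk> \<Longrightarrow> k \<odot>\<^bsub>\<D>\<^esub> f \<in> carrier \<D>"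
    and "\<zero>\<^bsub>\<D>\<^esub> \<in> carrier \<D>" "\<one>\<^bsub>\<D>\<^esub> \<in> carrier \<D>"
proof -
  note cl = add_hom_closed[OF left_dual_hom]
  note simps = cl add_hom_add[OF left_dual_hom] left_dual_smult closed
  have lin: "f (P.elt (a \<rightharpoonup>\<^bsub>\<Sigma>'\<^esub> \<phi>) u) = a \<otimes>\<^bsub>A\<^esub> f (P.elt \<phi> u)"
    if "f \<in> carrier \<D>" "a \<in> carrier A" "\<phi> \<in> carrier \<Sigma>'" "u \<in> carrier \<Sigma>" for f a \<phi> u
    using that by (simp add: left_dual_smult closed flip: P.lsmult_elt)
  show "f \<oplus>\<^bsub>\<D>\<^esub> g \<in> carrier \<D>" if "f \<in> carrier \<D>" "g \<in> carrier \<D>" for f g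
    unfolding left_dual_simps(4)
    by (intro left_dualI add_homI)
      (use that in \<open>simp_all add: simps lin R.r_distr R.M.add_interchange\<close>)
  show "f \<otimes>\<^bsub>\<D>\<^esub> g \<in> carrier \<D>" if f: "f \<in> carrier \<D>" and g: "g \<in> carrier \<D>" for f g
    unfolding left_dual_simps(5)
  proof (rule left_dualI)
    show "(\<lambda>c. f (act g c)) \<in> add_hom C A"
      by (rule add_hom_compose[OF act_hom[OF left_dual_hom[OF g] left_dual_smult[OF g]] left_dual_hom[OF f]])
    \<comment> \<open>The operator \<open>act g\<close> changes only \<open>u\<close>, so the scalar
      in front of \<open>\<phi>\<close> is extracted by left linearity of \<open>f\<close>.\<close>
    show "f (act g (P.elt (a \<rightharpoonup>\<^bsub>\<Sigma>'\<^esub> \<phi>) u)) = a \<otimes>\<^bsub>A\<^esub> f (act g (P.elt \<phi> u))"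
      if "a \<in> carrier A" "\<phi> \<in> carrier \<Sigma>'" "u \<in> carrier \<Sigma>" for a \<phi> u
      using that left_dual_ops_apply(2)[OF f g, of _ u] lin[OF f, of a \<phi> "to_endo g u"] to_endo_closed[OF g]
      by (simp add: left_dual_simps(5) closed)
  qed
  show "k \<odot>\<^bsub>\<D>\<^esub> f \<in> carrier \<D>" if "k \<in> carrier K" "f \<in> carrier \<D>" for k f
    unfolding left_dual_simps(6)
    by (intro left_dualI add_homI)
      (use that in \<open>simp_all add: simps lin R.smult_r_distr R.smult_mult_right\<close>)
  show "\<zero>\<^bsub>\<D>\<^esub> \<in> carrier \<D>"
    unfolding left_dual_simps(2) by (intro left_dualI add_homI) simp_all
  show "\<one>\<^bsub>\<D>\<^esub> \<in> carrier \<D>"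
    unfolding left_dual_simps(3)
    by (intro left_dualI counit_hom) (simp add: counit_elt closed right_dual_apply)
qed

text \<open>By \<open>dual_to_endo\<close> the endomorphism determines the values of
  \<open>f\<close> on pure tensors, hence \<open>f\<close>.\<close>

lemma to_endo_inj: "inj_on to_endo (carrier \<D>)"
  by (intro inj_onI left_dual_eqI) (simp_all flip: dual_to_endo)

text \<open>The preimage of \<open>g\<close> evaluates \<open>\<phi>\<close> at \<open>g u\<close>.
  This is balanced because \<open>g\<close> commutes with the action of \<open>B\<close>, and left
  linear because \<open>A\<close> acts on the values of \<open>\<phi>\<close>.\<close>

lemma to_endo_surj:
  assumes g: "g \<in> carrier endo"
  shows "\<exists>f\<in>carrier \<D>. to_endo f = g"
proof -
  note g_simps = end_left_closed[OF g] end_left_add[OF g] end_left_smult[OF g]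
  have "balanced B \<Sigma>' \<Sigma> A (\<lambda>\<phi> u. \<phi> (g u))"
    by (intro balancedI)
      (simp_all add: g_simps right_dual_closed right_dual_add right_dual_apply)
  note lift = P.tensor_lift_add_monoid[OF A_group this]
  let ?f = "tensor_lift (add_monoid A) (\<lambda>\<phi> u. \<phi> (g u))"
  have f: "restrict ?f (carrier C) \<in> carrier \<D>"
    by (intro left_dualI lift(1)) (simp add: lift(2) closed right_dual_apply g_simps)
  have "to_endo (restrict ?f (carrier C)) = g"
    by (intro end_left_eqI[OF to_endo_in_endo[OF f] g] to_endo_eqI[OF f])
      (simp_all add: lift(2) closed g_simps)
  with f show ?thesis by blast
qed

lemma to_endo_bij: "bij_betw to_endo (carrier \<D>) (carrier endo)"
  unfolding bij_betw_def using to_endo_inj to_endo_in_endo to_endo_surj by blast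

text \<open>Each identity is tested against a functional \<open>\<phi>\<close>. For the product,
  \<open>\<phi>\<close> takes the value \<open>f (P.elt \<phi> (to_endo g u))\<close>, that is, its
  value at \<open>to_endo f (to_endo g u)\<close>; the multiplication of \<open>endo\<close> writes
  this composite with \<open>to_endo g\<close> first.\<close>

lemma to_endo_ops:
  shows "\<lbrakk>f \<in> carrier \<D>; g \<in> carrier \<D>\<rbrakk> \<Longrightarrow> to_endo (f \<oplus>\<^bsub>\<D>\<^esub> g) = to_endo f \<oplus>\<^bsub>endo\<^esub> to_endo g"
    and "\<lbrakk>f \<in> carrier \<D>; g \<in> carrier \<D>\<rbrakk> \<Longrightarrow> to_endo (f \<otimes>\<^bsub>\<D>\<^esub> g) = to_endo g \<otimes>\<^bsub>endo\<^esub> to_endo f"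
    and "\<lbrakk>k \<in> carrier K; f \<in> carrier \<D>\<rbrakk> \<Longrightarrow> to_endo (k \<odot>\<^bsub>\<D>\<^esub> f) = k \<odot>\<^bsub>endo\<^esub> to_endo f"
    and "to_endo \<zero>\<^bsub>\<D>\<^esub> = \<zero>\<^bsub>endo\<^esub>" "to_endo \<one>\<^bsub>\<D>\<^esub> = \<one>\<^bsub>endo\<^esub>"
proof -
  interpret E: assoc_algebra K endo by (rule end_left_assoc_algebra)
  note ops = left_dual_ops_closed
  note eqI = end_left_eqI[OF to_endo_in_endo _ to_endo_eqI]
  \<comment> \<open>On the left dual \<open>K\<close> acts through \<open>A\<close>, on
    \<open>endo\<close> through \<open>B\<close>. Since \<open>\<Sigma>\<close> centralizes
    \<open>K\<close>, functionals identify the two actions.\<close>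
  have kA: "\<phi> ((k \<odot>\<^bsub>B\<^esub> \<one>\<^bsub>B\<^esub>) \<rightharpoonup>\<^bsub>\<Sigma>\<^esub> v) = k \<odot>\<^bsub>A\<^esub> \<phi> v"
    if "k \<in> carrier K" "\<phi> \<in> carrier \<Sigma>'" "v \<in> carrier \<Sigma>" for k \<phi> v
    using that by (simp add: centralizes right_dual_smult R.smult_mult_right right_dual_closed)
  have zero: "\<phi> \<zero>\<^bsub>\<Sigma>\<^esub> = \<zero>\<^bsub>A\<^esub>" if "\<phi> \<in> carrier \<Sigma>'" for \<phi>
    by (rule add_hom_zero[OF S_group A_group right_dual_hom[OF that]])
  show "to_endo (f \<oplus>\<^bsub>\<D>\<^esub> g) = to_endo f \<oplus>\<^bsub>endo\<^esub> to_endo g" if "f \<in> carrier \<D>" "g \<in> carrier \<D>"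
    using that
    by (intro eqI ops E.a_closed to_endo_in_endo)
      (simp_all add: end_left_apply left_dual_ops_apply right_dual_add to_endo_closed dual_to_endo)
  show "to_endo (f \<otimes>\<^bsub>\<D>\<^esub> g) = to_endo g \<otimes>\<^bsub>endo\<^esub> to_endo f" if "f \<in> carrier \<D>" "g \<in> carrier \<D>"
    using that
    by (intro eqI ops E.m_closed to_endo_in_endo)
      (simp_all add: end_left_apply left_dual_ops_apply to_endo_closed dual_to_endo)
  show "to_endo (k \<odot>\<^bsub>\<D>\<^esub> f) = k \<odot>\<^bsub>endo\<^esub> to_endo f" if "k \<in> carrier K" "f \<in> carrier \<D>"
    using that
    by (intro eqI ops E.smult_closed to_endo_in_endo)
      (simp_all add: end_left_apply left_dual_ops_apply to_endo_closed dual_to_endo kA lsmult_closed)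
  show "to_endo \<zero>\<^bsub>\<D>\<^esub> = \<zero>\<^bsub>endo\<^esub>"
    by (intro eqI ops E.zero_closed) (simp_all add: end_left_apply left_dual_zero_apply zero)
  show "to_endo \<one>\<^bsub>\<D>\<^esub> = \<one>\<^bsub>endo\<^esub>"
    by (intro eqI ops E.one_closed) (simp_all add: end_left_apply left_dual_one_apply)
qed

lemma
  shows left_dual_assoc_algebra: "assoc_algebra K \<D>"
    and to_endo_anti_iso: "to_endo \<in> algebra_anti_iso K \<D> endo"
  by (rule assoc_algebra_anti_transport[OF end_left_assoc_algebra to_endo_bij];
      rule left_dual_ops_closed to_endo_ops; assumption)+

end

theorem proposition2p1:
  fixes K :: "'k ring"
    and A :: "('k, 'a) module"
    and B :: "('k, 'b) module"
    and \<Sigma> :: "('b, 'a, 's) bimodule"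
    and I :: "'i set"
    and e' :: "'i \<Rightarrow> 's \<Rightarrow> 'a"
    and e :: "'i \<Rightarrow> 's"
  assumes "assoc_algebra K A" and "assoc_algebra K B"
    and "bimodule K B A \<Sigma>"
    and "fin_gen_right A \<Sigma>" and "projective_right A \<Sigma>"
    and "dual_basis A \<Sigma> I e' e"
  defines "\<Sigma>' \<equiv> right_dual A \<Sigma>"
  defines "C \<equiv> tensor B \<Sigma>' \<Sigma>"
  shows "\<exists>\<Delta> \<epsilon>. coring K A C \<Delta> \<epsilon> \<and>
      (\<forall>\<phi>\<in>carrier \<Sigma>'. \<forall>u\<in>carrier \<Sigma>.
         \<Delta> (tensor_elt B \<Sigma>' \<Sigma> \<phi> u) =
           (\<Oplus>\<^bsub>tensor A C C\<^esub>i\<in>I.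
              tensor_elt A C C (tensor_elt B \<Sigma>' \<Sigma> \<phi> (e i)) (tensor_elt B \<Sigma>' \<Sigma> (e' i) u)) \<and>
         \<epsilon> (tensor_elt B \<Sigma>' \<Sigma> \<phi> u) = \<phi> u) \<and>
      assoc_algebra K (left_dual A C \<Delta> \<epsilon>) \<and>
      assoc_algebra K (end_left B \<Sigma>) \<and>
      (\<exists>h. h \<in> algebra_anti_iso K (left_dual A C \<Delta> \<epsilon>) (end_left B \<Sigma>))"
proof -
  \<comment> \<open>The given dual basis is the one built into the construction, so the
    comultiplication formula holds for these very \<open>e i\<close> and \<open>e' i\<close>. The
    witnesses are \<open>comult\<close>, \<open>counit\<close> and \<open>to_endo\<close>.\<close>
  interpret X: comatrix K B A \<Sigma> I e' e
    using assms(3,6) by (simp add: comatrix_def comatrix_axioms_def)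
  show ?thesis
    unfolding \<Sigma>'_def C_def
    using X.coring X.comult_elt X.counit_elt X.left_dual_assoc_algebra X.end_left_assoc_algebra
      X.to_endo_anti_iso
    by blast
qed

end
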